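(* Let $G$ be a countably infinite discrete amenable group, let $A$ be a finite set, and let $X\subseteq A^G$ be a subshift. Let $\{F_n\}_{n\ge1}$ be any tempered Følner sequence of $G$ with $F_1\subseteq F_2\subseteq\cdots$ and $\bigcup_nF_n=G$, and let $d$ be the metric on $A^G$ associated with $\{F_n\}$, that is, $d(x,x)=0$ and, for $x\ne y$, $d(x,y)=1$ if $x$ and $y$ do not coincide on $F_1$, and otherwise $d(x,y)=e^{-|F_n|}$ where $n$ is the maximal number such that $x_g=y_g$ for all $g\in F_n$. Then the Hausdorff dimension of $X$ with respect to $d$ equals the topological entropy of $(X,G)$: $$\dim(X)=h_{top}(X,G).$$
   Context: **Følner sequences.** A Følner sequence in $G$ is a sequence $\{F_n\}_{n\ge1}$ of nonempty finite subsets of $G$ with $\lim_{n\to\infty}\frac{|F_n\vartriangle gF_n|}{|F_n|}=0$ for all $g\in G$. The countable group $G$ is amenable if it has a Følner sequence. The sequence $\{F_n\}$ is *tempered* if there is a constant $C>0$, independent of $n$, such that $\left|\bigcup_{k<n}F_k^{-1}F_n\right|\le C|F_n|$ for every $n$. **Subshifts.** $A^G=\{(x_g)_{g\in G}:x_g\in A\}$ carries the product topology of the discrete topology on $A$. The group $G$ acts on it on the left by $g'(x_g)_{g\in G}=(x_{gg'})_{g\in G}$ for $g'\in G$. A subshift is a closed $G$-invariant subset $X$ of $A^G$. **Hausdorff dimension.** For $s\ge0$, $$\mu_s(X)=\lim_{\epsilon\to0}\inf_{\mathcal E}\sum_{E\in\mathcal E}\mathrm{diam}(E)^s,$$ where $\mathcal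 E$ ranges over countable coverings of $X$ by open subsets of $A^G$ with $\mathrm{diam}(E)\le\epsilon$ for all $E\in\mathcal E$ (diameters with respect to $d$), and $\dim(X)=\inf\{s\ge0:\mu_s(X)=0\}$. **Topological entropy.** For a finite open cover $\mathcal U$ of $X$ and a finite nonempty $F\subset G$, let $\mathcal U^F=\bigvee_{g\in F}g^{-1}\mathcal U=\{\bigcap_{g\in F}g^{-1}U_g:U_g\in\mathcal U\}$, and let $N(\mathcal U^F)$ be the minimal cardinality of a subcover of $\mathcal U^F$. Then $$h_{top}(X,G)=\sup_{\mathcal U}\lim_{n\to\infty}\frac1{|F_n|}\log N(\mathcal U^{F_n}),$$ where $\log$ is the natural logarithm and the supremum is over all finite open covers of $X$. It is a standard fact (Ornstein–Weiss) that the limit exists and does not depend on the choice of Følner sequence $\{F_n\}$. *)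

theory Defs
  imports "HOL-Analysis.Analysis" "HOL-Algebra.Coset"
begin

section \<open>Amenability\<close>

text \<open>Sequences are indexed from 0: \<open>F n\<close> is the set usually written $F_{n+1}$.\<close>

definition folner_sequence :: "('g, 'm) monoid_scheme \<Rightarrow> (nat \<Rightarrow> 'g set) \<Rightarrow> bool" where
  "folner_sequence G F \<longleftrightarrow>
     (\<forall>n. finite (F n) \<and> F n \<noteq> {} \<and> F n \<subseteq> carrier G) \<and>
     (\<forall>g\<in>carrier G.
        (\<lambda>n. real (card (sym_diff (F n) (g <#\<^bsub>G\<^esub> F n))) / real (card (F n))) \<longlonglongrightarrow> 0)"

definition amenable :: "('g, 'm) monoid_scheme \<Rightarrow> bool" where
  "amenable G \<longleftrightarrow> (\<exists>F. folner_sequence G F)"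

definition tempered :: "('g, 'm) monoid_scheme \<Rightarrow> (nat \<Rightarrow> 'g set) \<Rightarrow> bool" where
  "tempered G F \<longleftrightarrow>
     (\<exists>C::real. C > 0 \<and>
        (\<forall>n. real (card (\<Union>k<n. (set_inv\<^bsub>G\<^esub> (F k)) <#>\<^bsub>G\<^esub> F n)) \<le> C * real (card (F n))))"


section \<open>Subshifts\<close>

text \<open>The points of the full shift are extensional functions on \<open>carrier G\<close>, as in
  \<^const>\<open>product_topology\<close>.\<close>

definition full_shift :: "('g, 'm) monoid_scheme \<Rightarrow> 'a set \<Rightarrow> ('g \<Rightarrow> 'a) topology" where
  "full_shift G A = product_topology (\<lambda>_. discrete_topology A) (carrier G)"

definition shift :: "('g, 'm) monoid_scheme \<Rightarrow> 'g \<Rightarrow> ('g \<Rightarrow> 'a) \<Rightarrow> ('g \<Rightarrow> 'a)" where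
  "shift G h x = (\<lambda>g\<in>carrier G. x (g \<otimes>\<^bsub>G\<^esub> h))"

definition subshift :: "('g, 'm) monoid_scheme \<Rightarrow> 'a set \<Rightarrow> ('g \<Rightarrow> 'a) set \<Rightarrow> bool" where
  "subshift G A X \<longleftrightarrow>
     closedin (full_shift G A) X \<and> (\<forall>h\<in>carrier G. shift G h ` X \<subseteq> X)"

definition shift_dist :: "(nat \<Rightarrow> 'g set) \<Rightarrow> ('g \<Rightarrow> 'a) \<Rightarrow> ('g \<Rightarrow> 'a) \<Rightarrow> real" where
  "shift_dist F x y =
     (if x = y then 0
      else if \<exists>g\<in>F 0. x g \<noteq> y g then 1
      else exp (- real (card (F (GREATEST n. \<forall>g\<in>F n. x g = y g)))))"


section \<open>Hausdorff dimension\<close>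

text \<open>The diameter is a real supremum, hence meaningful only for bounded \<open>d\<close>;
  \<^const>\<open>shift_dist\<close> is bounded by 1.\<close>

definition diam :: "('x \<Rightarrow> 'x \<Rightarrow> real) \<Rightarrow> 'x set \<Rightarrow> real" where
  "diam d E = (if E = {} then 0 else SUP (x, y)\<in>E \<times> E. d x y)"

text \<open>Since \<open>0 powr 0 = 0\<close>, the case \<open>s = 0\<close> is separated, so that nonempty sets have
  \<open>diam d E ^ 0 = 1\<close>; the empty set always contributes 0.\<close>

definition diam_pow :: "('x \<Rightarrow> 'x \<Rightarrow> real) \<Rightarrow> real \<Rightarrow> 'x set \<Rightarrow> real" where
  "diam_pow d s E = (if E = {} then 0 else if s = 0 then 1 else diam d E powr s)"

definition open_coverings ::
  "'x topology \<Rightarrow> ('x \<Rightarrow> 'x \<Rightarrow> real) \<Rightarrow> 'x set \<Rightarrow> real \<Rightarrow> 'x set set set" where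
  "open_coverings T d X \<epsilon> =
     {\<E>. countable \<E> \<and> (\<forall>E\<in>\<E>. openin T E \<and> diam d E \<le> \<epsilon>) \<and> X \<subseteq> \<Union>\<E>}"

definition hausdorff_measure ::
  "'x topology \<Rightarrow> ('x \<Rightarrow> 'x \<Rightarrow> real) \<Rightarrow> real \<Rightarrow> 'x set \<Rightarrow> ennreal" where
  "hausdorff_measure T d s X =
     Lim (at_right 0)
       (\<lambda>\<epsilon>. INF \<E>\<in>open_coverings T d X \<epsilon>. \<Sum>\<^sub>\<infinity>E\<in>\<E>. ennreal (diam_pow d s E))"

definition hausdorff_dim ::
  "'x topology \<Rightarrow> ('x \<Rightarrow> 'x \<Rightarrow> real) \<Rightarrow> 'x set \<Rightarrow> ereal" where
  "hausdorff_dim T d X = Inf (ereal ` {s. s \<ge> 0 \<and> hausdorff_measure T d s X = 0})"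


section \<open>Topological entropy\<close>

definition finite_open_covers :: "'x topology \<Rightarrow> 'x set \<Rightarrow> 'x set set set" where
  "finite_open_covers T X =
     {\<U>. finite \<U> \<and> (\<forall>U\<in>\<U>. openin (subtopology T X) U) \<and> \<Union>\<U> = X}"

definition join_cover ::
  "('g, 'm) monoid_scheme \<Rightarrow> ('g \<Rightarrow> 'a) set \<Rightarrow> ('g \<Rightarrow> 'a) set set \<Rightarrow> 'g set \<Rightarrow> ('g \<Rightarrow> 'a) set set" where
  "join_cover G X \<U> F = {(\<Inter>g\<in>F. {x \<in> X. shift G g x \<in> U g}) | U. U \<in> F \<rightarrow> \<U>}"

definition min_subcover_card :: "'x set \<Rightarrow> 'x set set \<Rightarrow> nat" where
  "min_subcover_card X \<V> = (LEAST k. \<exists>\<W>\<subseteq>\<V>. finite \<W> \<and> X \<subseteq> \<Union>\<W> \<and> card \<W> = k)"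

text \<open>The limit along Folner sequences exists and is the same for all of them
  (Ornstein--Weiss); the entropy of a cover is this common limit. For empty \<open>X\<close> the
  convention \<open>ln 0 = 0\<close> gives entropy 0.\<close>

definition cover_entropy ::
  "('g, 'm) monoid_scheme \<Rightarrow> ('g \<Rightarrow> 'a) set \<Rightarrow> ('g \<Rightarrow> 'a) set set \<Rightarrow> real" where
  "cover_entropy G X \<U> =
     (THE L. \<forall>F. folner_sequence G F \<longrightarrow>
        (\<lambda>n. ln (real (min_subcover_card X (join_cover G X \<U> (F n)))) / real (card (F n)))
          \<longlonglongrightarrow> L)"

definition h_top :: "('g, 'm) monoid_scheme \<Rightarrow> 'a set \<Rightarrow> ('g \<Rightarrow> 'a) set \<Rightarrow> ereal" where
  "h_top G A X = (SUP \<U>\<in>finite_open_covers (full_shift G A) X. ereal (cover_entropy G X \<U>))"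

end

theory Submission
  imports Defs
begin

text \<open>Covering \<open>X\<close> by the cylinders over \<open>F n\<close> bounds the dimension by the entropy. Conversely, in a cover of \<open>X\<close>
  by small cylinders, each shift of a point \<open>x\<close> by some \<open>c\<close> lies in a cylinder, which prescribes \<open>x\<close> on a translate
  \<open>F n #> c\<close>. Choosing translates greedily, from large \<open>n\<close> to small, temperedness yields an almost disjoint
  family filling a fixed proportion of a large Folner set. Repeating this with covers of smaller and smaller
  levels fills almost everything, and counting the possible families with weights \<open>exp (- s * card (F n))\<close> bounds
  the number of patterns by \<open>exp ((s + \<xi>) * card (F n))\<close>. The same quasi-tilings, with a single shape per layer,
  prove that the limits defining the entropy exist.\<close>

section \<open>Quasi-tilings\<close>

text \<open>A Hausdorff cover gives cylinders of different levels to different shifts of one point,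
  so a pattern cannot be cut into blocks of one shape, and the prescribed translates overlap without
  control. A Vitali-type selection repairs this: if \<open>F k #> c\<close> meets
  \<open>F m #> c'\<close> with \<open>k < m\<close>, then \<open>c\<close> lies in the product of
  the inverse of \<open>F k\<close> with \<open>F m #> c'\<close>, and temperedness bounds exactly
  the number of such \<open>c\<close>. One selection only guarantees a fraction \<kappa> depending
  on \<epsilon> and the tempering constant, so many layers are needed. Later layers use much smaller
  tiles, so that few of them cross the border of what is already filled. The metric suits the count:
  the weight \<open>exp (- s * card (F n))\<close> of a tile depends on its size only, so the
  weights of an almost disjoint family inside \<open>E\<close> multiply to at least
  \<open>exp (- s * card E / (1 - \<epsilon>))\<close>. Compactness of \<open>X\<close> makes the
  covers finite; hence each layer has finitely many shapes, and a large Folner set is almost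
  invariant under all of them.\<close>

definition bdry :: "('g, 'm) monoid_scheme \<Rightarrow> 'g set \<Rightarrow> 'g set \<Rightarrow> 'g set" where
  "bdry G K E = {c \<in> carrier G. \<exists>k\<in>K. (c \<in> E) \<noteq> (k \<otimes>\<^bsub>G\<^esub> c \<in> E)}"

lemma (in group) r_coset_image: "T #> c = (\<lambda>t. t \<otimes> c) ` T"
  by (auto simp: r_coset_def)

lemma (in group) inj_on_r_mult: "T \<subseteq> carrier G \<Longrightarrow> c \<in> carrier G \<Longrightarrow> inj_on (\<lambda>t. t \<otimes> c) T"
  by (auto simp: inj_on_def subset_iff)

lemma (in group) card_r_coset: "T \<subseteq> carrier G \<Longrightarrow> c \<in> carrier G \<Longrightarrow> card (T #> c) = card T"
  by (simp add: r_coset_image card_image inj_on_r_mult)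

lemma (in group) finite_r_coset: "finite T \<Longrightarrow> finite (T #> c)"
  by (simp add: r_coset_image)

text \<open>Left multiplication by \<open>K\<close> commutes with right translation of
  \<open>E\<close>, so boundaries move along with tiles. If \<open>K\<close> contains a tile shape,
  a tile with centre in \<open>E\<close> that leaves \<open>E\<close> has its centre in
  \<open>bdry G K E\<close>. As \<open>k \<otimes> c\<close> lies in \<open>E\<close> iff
  \<open>c\<close> lies in the left translate of \<open>E\<close> by \<open>inv k\<close>, the
  Folner condition controls this set.\<close>

lemma (in group) bdry_subset:
  assumes "K \<subseteq> carrier G" "E \<subseteq> carrier G"
  shows "bdry G K E \<subseteq> (\<Union>k\<in>K. sym_diff E (l_coset G (inv k) E))"
proof
  fix c assume "c \<in> bdry G K E"
  then obtain k where c: "c \<in> carrier G" and k: "k \<in> K" "(c \<in> E) \<noteq> (k \<otimes> c \<in> E)"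
    by (auto simp: bdry_def)
  have kG: "k \<in> carrier G" using k assms by auto
  have "c \<in> l_coset G (inv k) E \<longleftrightarrow> k \<otimes> c \<in> E"
  proof
    assume "c \<in> l_coset G (inv k) E"
    then obtain h where h: "h \<in> E" "c = inv k \<otimes> h" by (auto simp: l_coset_def)
    then have "k \<otimes> c = h" using assms kG by (auto simp: m_assoc[symmetric])
    with h show "k \<otimes> c \<in> E" by simp
  next
    assume "k \<otimes> c \<in> E"
    moreover have "c = inv k \<otimes> (k \<otimes> c)" using c kG by (simp add: m_assoc[symmetric])
    ultimately show "c \<in> l_coset G (inv k) E" by (auto simp: l_coset_def)
  qed
  then show "c \<in> (\<Union>k\<in>K. sym_diff E (l_coset G (inv k) E))" using k by blast
qed

lemma (in group) finite_bdry:
  assumes "finite K" "K \<subseteq> carrier G" "finite E" "E \<subseteq> carrier G"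
  shows "finite (bdry G K E)"
  by (rule finite_subset[OF bdry_subset]) (use assms in \<open>auto simp: l_coset_def\<close>)

lemma (in group) folner_bdry:
  assumes F: "folner_sequence G F" and K: "finite K" "K \<subseteq> carrier G" and "\<delta> > 0"
  shows "eventually (\<lambda>n. real (card (bdry G K (F n))) \<le> \<delta> * real (card (F n))) sequentially"
proof -
  have fin: "finite (F n)" "F n \<noteq> {}" "F n \<subseteq> carrier G" for n
    using F by (auto simp: folner_sequence_def)
  let ?r = "\<lambda>k n. real (card (sym_diff (F n) (l_coset G (inv k) (F n)))) / real (card (F n))"
  have "(\<lambda>n. \<Sum>k\<in>K. ?r k n) \<longlonglongrightarrow> (\<Sum>k\<in>K. 0)"
    by (rule tendsto_sum) (use F K in \<open>auto simp: folner_sequence_def\<close>)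
  then have "eventually (\<lambda>n. (\<Sum>k\<in>K. ?r k n) < \<delta>) sequentially"
    using \<open>\<delta> > 0\<close> order_tendstoD(2) by fastforce
  then show ?thesis
  proof eventually_elim
    case (elim n)
    have "card (bdry G K (F n)) \<le> card (\<Union>k\<in>K. sym_diff (F n) (l_coset G (inv k) (F n)))"
      using bdry_subset[OF K(2) fin(3)] K fin by (intro card_mono) (auto simp: l_coset_def)
    also have "\<dots> \<le> (\<Sum>k\<in>K. card (sym_diff (F n) (l_coset G (inv k) (F n))))"
      using K(1) by (rule card_UN_le)
    finally have "real (card (bdry G K (F n))) \<le> (\<Sum>k\<in>K. real (card (sym_diff (F n) (l_coset G (inv k) (F n)))))"
      unfolding of_nat_sum[symmetric] by linarith
    also have "\<dots> = (\<Sum>k\<in>K. ?r k n) * real (card (F n))"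
      using fin by (simp add: sum_divide_distrib[symmetric])
    also have "\<dots> \<le> \<delta> * real (card (F n))" using elim by (intro mult_right_mono) auto
    finally show ?case .
  qed
qed

text \<open>A family of maximal size with the first bound also has the second: a centre of
  \<open>A\<close> outside it cannot be added, so its translate has at least a fraction \<epsilon>
  inside the union, and the members have all of theirs. Counting the incidences twice finishes,
  since a point lies in at most \<open>card T\<close> translates of \<open>T\<close>.\<close>

lemma (in group) exists_quasi_disjoint_translates:
  assumes T: "finite T" "T \<noteq> {}" "T \<subseteq> carrier G" and A: "finite A" "A \<subseteq> carrier G"
    and \<epsilon>: "0 < \<epsilon>" "\<epsilon> \<le> (1::real)"
  obtains C where "C \<subseteq> A"
    "(1 - \<epsilon>) * (real (card T) * real (card C)) \<le> real (card (\<Union>c\<in>C. T #> c))"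
    "\<epsilon> * real (card A) \<le> real (card (\<Union>c\<in>C. T #> c))"
proof -
  define good where "good C \<longleftrightarrow> C \<subseteq> A \<and>
    (1 - \<epsilon>) * (real (card T) * real (card C)) \<le> real (card (\<Union>c\<in>C. T #> c))" for C
  have "good {}" by (simp add: good_def)
  moreover have "\<And>C. good C \<Longrightarrow> card C < card A + 1"
    using A(1) by (auto simp: good_def less_Suc_eq_le intro: card_mono)
  ultimately obtain C where C: "good C" and mx: "\<And>D. good D \<Longrightarrow> card D \<le> card C"
    using ex_has_greatest_nat[of good "{}" card "card A + 1"] by (metis less_imp_le)
  define U where "U = (\<Union>c\<in>C. T #> c)"
  have CA: "C \<subseteq> A" "finite C" using C A finite_subset by (auto simp: good_def)
  have finU: "finite U" using CA T by (auto simp: U_def finite_r_coset)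
  have big: "\<epsilon> * real (card T) \<le> real (card ((T #> c) \<inter> U))" if c: "c \<in> A" for c
  proof (cases "c \<in> C")
    case True
    then have "(T #> c) \<inter> U = T #> c" by (auto simp: U_def)
    then show ?thesis using card_r_coset[OF T(3)] c A \<epsilon> by (auto simp: mult_left_le_one_le)
  next
    case False
    have "\<not> good (insert c C)" using mx[of "insert c C"] False CA by auto
    moreover have "insert c C \<subseteq> A" using CA c by auto
    moreover have "(\<Union>c\<in>insert c C. T #> c) = U \<union> ((T #> c) - U)" by (auto simp: U_def)
    ultimately have "real (card (U \<union> ((T #> c) - U))) < (1 - \<epsilon>) * (real (card T) * (real (card C) + 1))"
      using False CA by (auto simp: good_def add.commute)
    moreover have "card (U \<union> ((T #> c) - U)) = card U + card ((T #> c) - U)"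
      by (rule card_Un_disjoint) (use finU T in \<open>auto simp: finite_r_coset\<close>)
    moreover have "(1 - \<epsilon>) * (real (card T) * real (card C)) \<le> real (card U)"
      using C by (auto simp: good_def U_def)
    ultimately have "real (card ((T #> c) - U)) < (1 - \<epsilon>) * real (card T)"
      by (simp add: algebra_simps)
    moreover have "card (T #> c) = card ((T #> c) \<inter> U) + card ((T #> c) - U)"
      using finite_r_coset[OF T(1)] by (metis card_Int_Diff)
    moreover have "card (T #> c) = card T" using card_r_coset[OF T(3)] c A by auto
    ultimately show ?thesis by (simp add: algebra_simps)
  qed
  have "\<epsilon> * real (card T) * real (card A) \<le> (\<Sum>c\<in>A. real (card ((T #> c) \<inter> U)))"
    using sum_mono[of A "\<lambda>_. \<epsilon> * real (card T)"] big by (simp add: mult.commute)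
  also have "\<dots> = real (\<Sum>c\<in>A. card {u\<in>U. u \<in> T #> c})"
    by (simp add: Int_def conj_commute)
  also have "(\<Sum>c\<in>A. card {u\<in>U. u \<in> T #> c}) = (\<Sum>u\<in>U. card {c\<in>A. u \<in> T #> c})"
    by (rule sum_multicount_gen) (use finU A in auto)
  also have "real \<dots> \<le> real (card U * card T)"
  proof -
    have "card {c\<in>A. u \<in> T #> c} \<le> card T" for u
    proof -
      have "{c\<in>A. u \<in> T #> c} \<subseteq> (\<lambda>t. inv t \<otimes> u) ` T"
      proof
        fix c assume "c \<in> {c\<in>A. u \<in> T #> c}"
        then obtain t where t: "t \<in> T" "u = t \<otimes> c" and c: "c \<in> A" by (auto simp: r_coset_def)
        then have "c = inv t \<otimes> u" using T A by (auto simp: m_assoc[symmetric] subset_iff)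
        with t show "c \<in> (\<lambda>t. inv t \<otimes> u) ` T" by auto
      qed
      then have "card {c\<in>A. u \<in> T #> c} \<le> card ((\<lambda>t. inv t \<otimes> u) ` T)"
        using T by (intro card_mono) auto
      also have "\<dots> \<le> card T" using T by (intro card_image_le) auto
      finally show ?thesis .
    qed
    then have "(\<Sum>u\<in>U. card {c\<in>A. u \<in> T #> c}) \<le> (\<Sum>u\<in>U. card T)" by (intro sum_mono)
    also have "\<dots> = card U * card T" by simp
    finally show ?thesis unfolding of_nat_le_iff .
  qed
  finally have "(\<epsilon> * real (card A)) * real (card T) \<le> real (card U) * real (card T)"
    by (simp add: mult_ac)
  then have "\<epsilon> * real (card A) \<le> real (card U)"
    using T by (simp add: card_gt_0_iff)
  then show thesis using that[of C] C by (auto simp: good_def U_def)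
qed

text \<open>Levels are processed from large to small. A rejected centre \<open>c\<close> of level \<open>k\<close> has a tile meeting an
  already chosen tile \<open>T m #> c'\<close> with \<open>m > k\<close>, so \<open>c\<close> lies in \<open>D m #> c'\<close>; temperedness bounds
  the total size of these sets.\<close>

lemma (in group) exists_layer:
  fixes T D :: "nat \<Rightarrow> 'a set" and \<nu> :: "'a \<Rightarrow> nat" and C \<epsilon> :: real
  assumes T: "\<And>n. finite (T n)" "\<And>n. T n \<noteq> {}" "\<And>n. T n \<subseteq> carrier G"
    and D: "\<And>n. finite (D n)" "\<And>n. D n \<subseteq> carrier G" "\<And>n. real (card (D n)) \<le> C * real (card (T n))"
    and C: "C \<ge> 0"
    and A: "finite A" "A \<subseteq> carrier G" and \<epsilon>: "0 < \<epsilon>" "\<epsilon> < 1"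
    and TD: "\<And>k m g. k \<in> \<nu> ` A \<Longrightarrow> m \<in> \<nu> ` A \<Longrightarrow> k < m \<Longrightarrow> g \<in> carrier G \<Longrightarrow>
      (T k #> g) \<inter> T m \<noteq> {} \<Longrightarrow> g \<in> D m"
  obtains S where "S \<subseteq> A"
    "(1 - \<epsilon>) * (\<Sum>c\<in>S. real (card (T (\<nu> c)))) \<le> real (card (\<Union>c\<in>S. T (\<nu> c) #> c))"
    "real (card A) \<le> (1 / \<epsilon> + C / (1 - \<epsilon>)) * real (card (\<Union>c\<in>S. T (\<nu> c) #> c))"
proof -
  define U where "U S = (\<Union>c\<in>S. T (\<nu> c) #> c)" for S
  define AI where "AI I = {c\<in>A. \<nu> c \<in> I}" for I
  have finU: "finite (U S)" if "S \<subseteq> A" for S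
    using finite_subset[OF that A(1)] T by (auto simp: U_def finite_r_coset)
  \<comment> \<open>\<open>P\<close> collects the centres whose tile was still disjoint from the
    chosen ones when their level was reached; their number is charged to the newly covered set. All
    other centres are charged to the sets \<open>D\<close> of the chosen tiles.\<close>
  have "\<exists>S P. S \<subseteq> AI I \<and> (1 - \<epsilon>) * (\<Sum>c\<in>S. real (card (T (\<nu> c)))) \<le> real (card (U S)) \<and>
      finite P \<and> \<epsilon> * real (card P) \<le> real (card (U S)) \<and>
      AI I \<subseteq> P \<union> (\<Union>c\<in>S. D (\<nu> c) #> c)" if "finite I" "I \<subseteq> \<nu> ` A" for I
    using that
  proof (induction I rule: finite_linorder_min_induct)
    case empty
    show ?case by (intro exI[of _ "{}"]) (auto simp: AI_def)
  next
    \<comment> \<open>The induction rule adds \<open>n\<close> below all of \<open>I\<close>, so the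
      levels treated before are the larger ones.\<close>
    case (insert n I)
    then obtain S P where S: "S \<subseteq> AI I" "(1 - \<epsilon>) * (\<Sum>c\<in>S. real (card (T (\<nu> c)))) \<le> real (card (U S))"
      and P: "finite P" "\<epsilon> * real (card P) \<le> real (card (U S))" "AI I \<subseteq> P \<union> (\<Union>c\<in>S. D (\<nu> c) #> c)"
      by auto
    define B where "B = {c\<in>AI {n}. (T n #> c) \<inter> U S = {}}"
    have BA: "B \<subseteq> A" "finite B" "B \<subseteq> carrier G" using A by (auto simp: B_def AI_def)
    obtain Q where Q: "Q \<subseteq> B"
      "(1 - \<epsilon>) * (real (card (T n)) * real (card Q)) \<le> real (card (\<Union>c\<in>Q. T n #> c))"
      "\<epsilon> * real (card B) \<le> real (card (\<Union>c\<in>Q. T n #> c))"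
      using exists_quasi_disjoint_translates[OF T(1) T(2) T(3) BA(2,3) \<epsilon>(1)] \<epsilon>(2) by (metis less_imp_le)
    have SA: "S \<subseteq> A" using S by (auto simp: AI_def)
    then have SA: "S \<subseteq> A" "finite S" using finite_subset[OF _ A(1)] by auto
    have QA: "Q \<subseteq> A" "finite Q" using Q BA finite_subset[OF Q(1)] by auto
    have \<nu>Q: "\<nu> c = n" if "c \<in> Q" for c using that Q by (auto simp: B_def AI_def)
    have UQ: "U Q = (\<Union>c\<in>Q. T n #> c)" using \<nu>Q by (auto simp: U_def)
    have disj: "U S \<inter> U Q = {}" using Q by (auto simp: UQ B_def)
    have SQ: "S \<inter> Q = {}" using S(1) \<nu>Q insert.hyps by (auto simp: AI_def)
    have cU: "card (U (S \<union> Q)) = card (U S) + card (U Q)"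
      using disj finU[OF SA(1)] finU[OF QA(1)] by (simp add: U_def card_Un_disjoint UN_Un)
    have sumQ: "(\<Sum>c\<in>Q. real (card (T (\<nu> c)))) = real (card (T n)) * real (card Q)"
      using \<nu>Q by simp
    have 1: "(1 - \<epsilon>) * (\<Sum>c\<in>S \<union> Q. real (card (T (\<nu> c)))) \<le> real (card (U (S \<union> Q)))"
      using S(2) Q(2) SA QA SQ by (simp add: sum.union_disjoint cU sumQ UQ distrib_left)
    have "real (card (P \<union> B)) \<le> real (card P) + real (card B)"
      using card_Un_le[of P B] by linarith
    then have "\<epsilon> * real (card (P \<union> B)) \<le> \<epsilon> * (real (card P) + real (card B))"
      using \<epsilon> by (intro mult_left_mono) auto
    then have 2: "\<epsilon> * real (card (P \<union> B)) \<le> real (card (U (S \<union> Q)))"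
      using P(2) Q(3) by (simp add: cU UQ distrib_left)
    have 3: "AI (insert n I) \<subseteq> P \<union> B \<union> (\<Union>c\<in>S \<union> Q. D (\<nu> c) #> c)"
    proof
      fix c assume c: "c \<in> AI (insert n I)"
      show "c \<in> P \<union> B \<union> (\<Union>c\<in>S \<union> Q. D (\<nu> c) #> c)"
      proof (cases "\<nu> c = n")
        case False
        then have "c \<in> AI I" using c by (auto simp: AI_def)
        then show ?thesis using P(3) by auto
      next
        case True
        then have cn: "c \<in> A" "c \<in> AI {n}" using c by (auto simp: AI_def)
        show ?thesis
        proof (cases "c \<in> B")
          case False
          then obtain t c' s where c': "c' \<in> S" "t \<in> T n" "s \<in> T (\<nu> c')" "t \<otimes> c = s \<otimes> c'"
            using cn by (auto simp: B_def U_def r_coset_def)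
          have G: "c \<in> carrier G" "c' \<in> carrier G" "t \<in> carrier G" "s \<in> carrier G"
            using c' cn SA A T by blast+
          let ?g = "c \<otimes> inv c'"
          have "t \<otimes> ?g = s"
            using G c'(4) by (simp add: m_assoc[symmetric] inv_solve_right')
          then have "(T n #> ?g) \<inter> T (\<nu> c') \<noteq> {}"
            using c' by (auto simp: r_coset_def)
          moreover have "\<nu> c' \<in> I" using c' S(1) by (auto simp: AI_def)
          moreover have "n < \<nu> c'" using calculation insert.hyps by auto
          ultimately have "?g \<in> D (\<nu> c')"
            using TD[of n "\<nu> c'" ?g] insert.prems G by auto
          moreover have "c = ?g \<otimes> c'" using G by (simp add: m_assoc)
          ultimately have "c \<in> D (\<nu> c') #> c'" by (auto simp: r_coset_def)
          then show ?thesis using c' by auto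
        qed auto
      qed
    qed
    have "S \<union> Q \<subseteq> AI (insert n I)" using S(1) QA(1) \<nu>Q by (auto simp: AI_def)
    with 1 2 3 P(1) BA(2) show ?case
      by (intro exI[of _ "S \<union> Q"] exI[of _ "P \<union> B"]) auto
  qed
  from this[of "\<nu> ` A"] A obtain S P where S: "S \<subseteq> AI (\<nu> ` A)"
      "(1 - \<epsilon>) * (\<Sum>c\<in>S. real (card (T (\<nu> c)))) \<le> real (card (U S))"
      and P: "finite P" "\<epsilon> * real (card P) \<le> real (card (U S))" "AI (\<nu> ` A) \<subseteq> P \<union> (\<Union>c\<in>S. D (\<nu> c) #> c)"
    by auto
  have SA: "S \<subseteq> A" using S by (auto simp: AI_def)
  then have SA: "S \<subseteq> A" "finite S" using finite_subset[OF _ A(1)] by auto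
  have "A \<subseteq> P \<union> (\<Union>c\<in>S. D (\<nu> c) #> c)" using P(3) by (auto simp: AI_def)
  then have "card A \<le> card (P \<union> (\<Union>c\<in>S. D (\<nu> c) #> c))"
    using P(1) SA D(1) by (intro card_mono) (auto simp: finite_r_coset)
  also have "\<dots> \<le> card P + card (\<Union>c\<in>S. D (\<nu> c) #> c)" by (rule card_Un_le)
  also have "\<dots> \<le> card P + (\<Sum>c\<in>S. card (D (\<nu> c) #> c))" using card_UN_le[OF SA(2)] by auto
  also have "(\<Sum>c\<in>S. card (D (\<nu> c) #> c)) = (\<Sum>c\<in>S. card (D (\<nu> c)))"
    using SA A D(2) by (intro sum.cong card_r_coset) auto
  \<comment> \<open>In the final constant, \<open>1 / \<epsilon>\<close> comes from
    \<open>P\<close>, and \<open>C / (1 - \<epsilon>)\<close> from the sets \<open>D\<close>,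
    because the chosen tiles have total size at most
    \<open>card (U S) / (1 - \<epsilon>)\<close>.\<close>
  finally have "real (card A) \<le> real (card P) + (\<Sum>c\<in>S. real (card (D (\<nu> c))))"
    unfolding of_nat_sum[symmetric] by linarith
  also have "(\<Sum>c\<in>S. real (card (D (\<nu> c)))) \<le> (\<Sum>c\<in>S. C * real (card (T (\<nu> c))))"
    by (rule sum_mono) (rule D(3))
  also have "\<dots> = C * (\<Sum>c\<in>S. real (card (T (\<nu> c))))" by (simp add: sum_distrib_left)
  also have "\<dots> \<le> C * (real (card (U S)) / (1 - \<epsilon>))"
    using S(2) \<epsilon> C by (intro mult_left_mono) (auto simp: field_simps)
  also have "real (card P) \<le> real (card (U S)) / \<epsilon>"
    using P(2) \<epsilon> by (simp add: field_simps)
  finally have "real (card A) \<le> (1 / \<epsilon> + C / (1 - \<epsilon>)) * real (card (U S))"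
    by (simp add: algebra_simps)
  then show thesis using that[of S] SA S(2) by (auto simp: U_def)
qed

text \<open>By \<open>inv\<close> and \<open>invE\<close>, \<open>E\<close> and all tiles of earlier
  layers are almost invariant under the shapes of a later layer. So all but
  \<open>3 * \<delta> * card E\<close> of the free points are centres whose next tile stays in the
  free part, and \<open>exists_layer\<close> covers at least \<kappa> times the number of these
  centres. The free proportion therefore obeys the recursion r \<mapsto> (1 - \<kappa>) r + 3
  \<delta> \<kappa>, whose fixed point is 3 \<delta>; this explains the bound.\<close>

lemma (in group) exists_quasi_tiling:
  fixes T D :: "nat \<Rightarrow> 'a set" and \<nu> :: "nat \<Rightarrow> 'a \<Rightarrow> nat" and I :: "nat \<Rightarrow> nat set"
    and C \<epsilon> \<delta> \<kappa> :: real
  assumes T: "\<And>n. finite (T n)" "\<And>n. T n \<noteq> {}" "\<And>n. T n \<subseteq> carrier G"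
    and D: "\<And>n. finite (D n)" "\<And>n. D n \<subseteq> carrier G" "\<And>n. real (card (D n)) \<le> C * real (card (T n))"
    and C: "C \<ge> 0"
    and E: "finite E" "E \<subseteq> carrier G" and \<epsilon>: "0 < \<epsilon>" "\<epsilon> \<le> 1 / 2" and \<delta>: "\<delta> \<ge> 0"
    and \<kappa>: "\<kappa> = 1 / (1 / \<epsilon> + C / (1 - \<epsilon>))"
    and I: "\<And>j. j < M \<Longrightarrow> finite (I j)" "\<And>j c. j < M \<Longrightarrow> c \<in> E \<Longrightarrow> \<nu> j c \<in> I j"
    and TD: "\<And>j k m g. j < M \<Longrightarrow> k \<in> I j \<Longrightarrow> m \<in> I j \<Longrightarrow> k < m \<Longrightarrow> g \<in> carrier G \<Longrightarrow>
      (T k #> g) \<inter> T m \<noteq> {} \<Longrightarrow> g \<in> D m"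
    and inv: "\<And>i j n. i < j \<Longrightarrow> j < M \<Longrightarrow> n \<in> I i \<Longrightarrow>
      real (card (bdry G (\<Union>k\<in>I j. T k) (T n))) \<le> \<delta> * real (card (T n))"
    and invE: "\<And>j. j < M \<Longrightarrow> real (card (bdry G (\<Union>k\<in>I j. T k) E)) \<le> \<delta> * real (card E)"
  shows "\<exists>S. S \<subseteq> {..<M} \<times> E \<and> (\<forall>p\<in>S. T (\<nu> (fst p) (snd p)) #> snd p \<subseteq> E) \<and>
    (1 - \<epsilon>) * (\<Sum>p\<in>S. real (card (T (\<nu> (fst p) (snd p))))) \<le>
      real (card (\<Union>p\<in>S. T (\<nu> (fst p) (snd p)) #> snd p)) \<and>
    real (card (E - (\<Union>p\<in>S. T (\<nu> (fst p) (snd p)) #> snd p))) \<le> ((1 - \<kappa>) ^ M + 3 * \<delta>) * real (card E)"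
  using I TD inv invE
proof (induction M)
  case 0
  show ?case by (intro exI[of _ "{}"]) (use \<delta> in \<open>auto simp: algebra_simps\<close>)
next
  case (Suc M)
  define \<tau> where "\<tau> p = T (\<nu> (fst p) (snd p))" for p
  define tile where "tile p = \<tau> p #> snd p" for p
  have "\<exists>S. S \<subseteq> {..<M} \<times> E \<and> (\<forall>p\<in>S. tile p \<subseteq> E) \<and>
    (1 - \<epsilon>) * (\<Sum>p\<in>S. real (card (\<tau> p))) \<le> real (card (\<Union>p\<in>S. tile p)) \<and>
    real (card (E - (\<Union>p\<in>S. tile p))) \<le> ((1 - \<kappa>) ^ M + 3 * \<delta>) * real (card E)"
    unfolding tile_def \<tau>_def
  proof (rule Suc.IH, goal_cases)
    case (3 j k m g) show ?case by (rule Suc.prems(3)[of j k m]) (use 3 in auto)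
  qed (use Suc.prems in auto)
  then obtain S where S: "S \<subseteq> {..<M} \<times> E" "\<And>p. p \<in> S \<Longrightarrow> tile p \<subseteq> E"
    and sumS: "(1 - \<epsilon>) * (\<Sum>p\<in>S. real (card (\<tau> p))) \<le> real (card (\<Union>p\<in>S. tile p))"
    and left: "real (card (E - (\<Union>p\<in>S. tile p))) \<le> ((1 - \<kappa>) ^ M + 3 * \<delta>) * real (card E)"
    by blast
  define U where "U = (\<Union>p\<in>S. tile p)"
  define W where "W = E - U"
  \<comment> \<open>Admitting only tiles inside the free part \<open>W\<close> makes different
    layers disjoint; overlaps occur only within a layer.\<close>
  define A where "A = {c\<in>W. T (\<nu> M c) #> c \<subseteq> W}"
  define K where "K = (\<Union>k\<in>I M. T k)"
  have finS: "finite S" using S(1) E(1) by (meson finite_SigmaI finite_lessThan finite_subset)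
  have UE: "U \<subseteq> E" using S by (auto simp: U_def)
  have finU: "finite U" using UE E finite_subset by blast
  have K: "finite K" "K \<subseteq> carrier G" using Suc.prems(1)[of M] T by (auto simp: K_def)
  have AE: "A \<subseteq> E" "finite A" "A \<subseteq> carrier G" using E by (auto simp: A_def W_def)
  have sndS: "snd p \<in> carrier G" if "p \<in> S" for p using that S(1) E by force
  have fst_S: "fst p < M" if "p \<in> S" for p using that S(1) by force

  have "W - A \<subseteq> bdry G K E \<union> (\<Union>p\<in>S. bdry G K (\<tau> p) #> snd p)"
  proof
    fix c assume c: "c \<in> W - A"
    then obtain t where t: "t \<in> T (\<nu> M c)" "t \<otimes> c \<notin> W" by (auto simp: A_def r_coset_def)
    have cE: "c \<in> E" "c \<notin> U" "c \<in> carrier G" using c E by (auto simp: W_def)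
    have tK: "t \<in> K" using t Suc.prems(2)[of M c] cE by (auto simp: K_def)
    show "c \<in> bdry G K E \<union> (\<Union>p\<in>S. bdry G K (\<tau> p) #> snd p)"
    proof (cases "t \<otimes> c \<in> E")
      case False
      then show ?thesis using cE tK by (auto simp: bdry_def)
    next
      case True
      then have "t \<otimes> c \<in> U" using t by (auto simp: W_def)
      then obtain p s where p: "p \<in> S" "s \<in> \<tau> p" "t \<otimes> c = s \<otimes> snd p"
        by (auto simp: U_def tile_def r_coset_def)
      have G: "t \<in> carrier G" "s \<in> carrier G" "snd p \<in> carrier G"
        using tK K(2) p(1,2) T(3) sndS unfolding \<tau>_def by blast+
      let ?g = "c \<otimes> inv (snd p)"
      have 1: "t \<otimes> ?g = s" using G p(3) cE by (simp add: m_assoc[symmetric] inv_solve_right')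
      have 2: "c = ?g \<otimes> snd p" using G cE by (simp add: m_assoc)
      \<comment> \<open>\<open>c\<close> avoids the tile of \<open>p\<close> while
        \<open>t \<otimes> c\<close> lies in it. Moved back to the shape \<open>\<tau> p\<close>,
        this says that \<open>?g\<close> is in the boundary of the shape.\<close>
      have "?g \<notin> \<tau> p"
      proof
        assume "?g \<in> \<tau> p"
        then have "c \<in> tile p" using 2 by (auto simp: tile_def r_coset_def)
        then show False using cE p by (auto simp: U_def)
      qed
      then have "?g \<in> bdry G K (\<tau> p)" using 1 p tK G cE by (auto simp: bdry_def)
      then have "c \<in> bdry G K (\<tau> p) #> snd p" using 2 by (auto simp: r_coset_def)
      then show ?thesis using p by auto
    qed
  qed
  moreover have finb: "finite (bdry G K E)" "\<And>p. finite (bdry G K (\<tau> p))"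
    using finite_bdry[OF K] E T by (auto simp: \<tau>_def)
  ultimately have "card (W - A) \<le> card (bdry G K E \<union> (\<Union>p\<in>S. bdry G K (\<tau> p) #> snd p))"
    using finS by (intro card_mono) (auto simp: finite_r_coset)
  also have "\<dots> \<le> card (bdry G K E) + card (\<Union>p\<in>S. bdry G K (\<tau> p) #> snd p)"
    by (rule card_Un_le)
  also have "\<dots> \<le> card (bdry G K E) + (\<Sum>p\<in>S. card (bdry G K (\<tau> p) #> snd p))"
    using card_UN_le[OF finS] by auto
  also have "(\<Sum>p\<in>S. card (bdry G K (\<tau> p) #> snd p)) = (\<Sum>p\<in>S. card (bdry G K (\<tau> p)))"
    using sndS by (intro sum.cong card_r_coset) (auto simp: bdry_def)
  finally have "real (card (W - A)) \<le> real (card (bdry G K E)) + (\<Sum>p\<in>S. real (card (bdry G K (\<tau> p))))"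
    unfolding of_nat_sum[symmetric] by linarith
  also have "(\<Sum>p\<in>S. real (card (bdry G K (\<tau> p)))) \<le> (\<Sum>p\<in>S. \<delta> * real (card (\<tau> p)))"
  proof (rule sum_mono)
    fix p assume p: "p \<in> S"
    then have "\<nu> (fst p) (snd p) \<in> I (fst p)" using S(1) fst_S by (intro Suc.prems(2)) force+
    then show "real (card (bdry G K (\<tau> p))) \<le> \<delta> * real (card (\<tau> p))"
      unfolding K_def \<tau>_def using fst_S[OF p] by (intro Suc.prems(4)) auto
  qed
  also have "\<dots> = \<delta> * (\<Sum>p\<in>S. real (card (\<tau> p)))" by (simp add: sum_distrib_left)
  \<comment> \<open>Overlaps cost a factor of at most \<open>1 / (1 - \<epsilon>) \<le> 2\<close>.
    Together with the boundary of \<open>E\<close> itself this gives the 3 in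
    \<open>3 * \<delta>\<close>.\<close>
  also have "\<dots> \<le> \<delta> * (2 * real (card E))"
  proof (intro mult_left_mono \<delta>)
    let ?s = "\<Sum>p\<in>S. real (card (\<tau> p))"
    have "1 / 2 * ?s \<le> (1 - \<epsilon>) * ?s" using \<epsilon> by (intro mult_right_mono sum_nonneg) auto
    also have "\<dots> \<le> real (card U)" using sumS by (simp add: U_def)
    also have "\<dots> \<le> real (card E)" using UE E by (simp add: card_mono)
    finally show "?s \<le> 2 * real (card E)" by simp
  qed
  also have "real (card (bdry G K E)) \<le> \<delta> * real (card E)" unfolding K_def by (rule Suc.prems(5)) simp
  finally have bad: "real (card (W - A)) \<le> 3 * \<delta> * real (card E)" by simp

  have \<epsilon>1: "\<epsilon> < 1" using \<epsilon> by simp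
  obtain R where R: "R \<subseteq> A"
    "(1 - \<epsilon>) * (\<Sum>c\<in>R. real (card (T (\<nu> M c)))) \<le> real (card (\<Union>c\<in>R. T (\<nu> M c) #> c))"
    "real (card A) \<le> (1 / \<epsilon> + C / (1 - \<epsilon>)) * real (card (\<Union>c\<in>R. T (\<nu> M c) #> c))"
  proof (rule exists_layer[OF T D C AE(2,3) \<epsilon>(1) \<epsilon>1, where \<nu> = "\<nu> M"])
    fix k m g
    assume "k \<in> \<nu> M ` A" "m \<in> \<nu> M ` A" "k < m" "g \<in> carrier G" "(T k #> g) \<inter> T m \<noteq> {}"
    then show "g \<in> D m"
      using Suc.prems(2)[of M] AE(1) by (intro Suc.prems(3)[of M k m g]) auto
  qed (rule that)
  define V where "V = (\<Union>c\<in>R. T (\<nu> M c) #> c)"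
  have VW: "V \<subseteq> W" using R(1) by (auto simp: V_def A_def)
  have finR: "finite R" using R AE finite_subset by blast
  have k0: "1 / \<epsilon> + C / (1 - \<epsilon>) \<ge> 1"
  proof -
    have "1 / \<epsilon> \<ge> 1" using \<epsilon> by simp
    moreover have "C / (1 - \<epsilon>) \<ge> 0" using C \<epsilon>1 by simp
    ultimately show ?thesis by linarith
  qed
  then have \<kappa>01: "0 < \<kappa>" "\<kappa> \<le> 1" by (auto simp: \<kappa>)
  have \<kappa>V: "\<kappa> * real (card A) \<le> real (card V)"
    using R(3) k0 by (simp add: \<kappa> V_def field_simps)
  have finW: "finite W" using E by (simp add: W_def)
  have "real (card (W - V)) = real (card W) - real (card V)"
    using VW finW by (simp add: card_Diff_subset finite_subset card_mono of_nat_diff)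
  also have "\<dots> \<le> real (card W) - \<kappa> * real (card A)" using \<kappa>V by simp
  also have "real (card A) = real (card W) - real (card (W - A))"
  proof -
    have "A \<subseteq> W" by (auto simp: A_def)
    then show ?thesis using finW by (simp add: card_Diff_subset finite_subset card_mono of_nat_diff)
  qed
  also have "real (card W) - \<kappa> * (real (card W) - real (card (W - A))) =
      (1 - \<kappa>) * real (card W) + \<kappa> * real (card (W - A))" by (simp add: algebra_simps)
  also have "\<dots> \<le> (1 - \<kappa>) * (((1 - \<kappa>) ^ M + 3 * \<delta>) * real (card E)) + \<kappa> * (3 * \<delta> * real (card E))"
    using left bad \<kappa>01 by (intro add_mono mult_left_mono) (auto simp: W_def U_def)
  also have "\<dots> = ((1 - \<kappa>) ^ Suc M + 3 * \<delta>) * real (card E)" by (simp add: algebra_simps)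
  finally have leftV: "real (card (W - V)) \<le> ((1 - \<kappa>) ^ Suc M + 3 * \<delta>) * real (card E)" .

  define S' where "S' = S \<union> Pair M ` R"
  have disj: "S \<inter> Pair M ` R = {}" using fst_S by fastforce
  have tileR: "tile (M, c) = T (\<nu> M c) #> c" "\<tau> (M, c) = T (\<nu> M c)" for c
    by (auto simp: tile_def \<tau>_def)
  have US': "(\<Union>p\<in>S'. tile p) = U \<union> V" by (auto simp: S'_def U_def V_def tileR)
  have sumS': "(\<Sum>p\<in>S'. real (card (\<tau> p))) =
      (\<Sum>p\<in>S. real (card (\<tau> p))) + (\<Sum>c\<in>R. real (card (T (\<nu> M c))))"
    unfolding S'_def using disj finS finR
    by (simp add: sum.union_disjoint sum.reindex inj_on_def tileR)
  have "card (U \<union> V) = card U + card V"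
    using finU VW finW finite_subset by (intro card_Un_disjoint) (auto simp: W_def)
  then have "(1 - \<epsilon>) * (\<Sum>p\<in>S'. real (card (\<tau> p))) \<le> real (card (\<Union>p\<in>S'. tile p))"
    unfolding US' sumS' using sumS R(2) by (simp add: distrib_left U_def V_def)
  moreover have "E - (\<Union>p\<in>S'. tile p) = W - V" unfolding US' W_def by auto
  moreover have "S' \<subseteq> {..<Suc M} \<times> E" using S(1) R(1) AE by (auto simp: S'_def)
  moreover have "\<forall>p\<in>S'. tile p \<subseteq> E"
  proof
    fix p assume "p \<in> S'"
    then consider "p \<in> S" | c where "c \<in> R" "p = (M, c)" by (auto simp: S'_def)
    then show "tile p \<subseteq> E"
    proof cases
      case 2
      then have "tile p \<subseteq> V" by (auto simp: tileR V_def)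
      then show ?thesis using VW by (auto simp: W_def)
    qed (use S(2) in auto)
  qed
  ultimately have "S' \<subseteq> {..<Suc M} \<times> E \<and> (\<forall>p\<in>S'. tile p \<subseteq> E) \<and>
    (1 - \<epsilon>) * (\<Sum>p\<in>S'. real (card (\<tau> p))) \<le> real (card (\<Union>p\<in>S'. tile p)) \<and>
    real (card (E - (\<Union>p\<in>S'. tile p))) \<le> ((1 - \<kappa>) ^ Suc M + 3 * \<delta>) * real (card E)"
    using leftV by simp
  then show ?case unfolding tile_def \<tau>_def by (rule exI)
qed

section \<open>Choice of the layers\<close>

text \<open>Each choice has a threshold beyond which its property \<open>P\<close> holds. Starting
  every new choice beyond the thresholds of all earlier ones settles all pairs \<open>i < j\<close>
  at once.\<close>

lemma exists_layer_sequence: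
  fixes lev :: "'q \<Rightarrow> nat set"
  assumes "\<And>N. \<exists>q. good q \<and> (\<forall>n\<in>lev q. N \<le> n)"
    and "\<And>q. good q \<Longrightarrow> eventually (P q) sequentially"
  obtains Q :: "nat \<Rightarrow> 'q" where "\<And>j. good (Q j)" "\<And>i j n. i < j \<Longrightarrow> n \<in> lev (Q j) \<Longrightarrow> P (Q i) n"
proof -
  obtain f where f: "\<And>N. good (f N)" "\<And>N n. n \<in> lev (f N) \<Longrightarrow> N \<le> n" using assms(1) by metis
  obtain h where h: "\<And>q n. good q \<Longrightarrow> h q \<le> n \<Longrightarrow> P q n"
    using assms(2) unfolding eventually_sequentially by metis
  define N where "N = rec_nat 0 (\<lambda>_ n. max n (h (f n)))"
  have N: "N (Suc j) = max (N j) (h (f (N j)))" for j by (simp add: N_def)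
  have mono: "i \<le> j \<Longrightarrow> N i \<le> N j" for i j by (rule lift_Suc_mono_le[of N]) (auto simp: N)
  show thesis
  proof (rule that[of "\<lambda>j. f (N j)"])
    fix i j n assume ij: "i < j" "n \<in> lev (f (N j))"
    have "h (f (N i)) \<le> N (Suc i)" by (simp add: N)
    also have "\<dots> \<le> N j" using ij by (intro mono) auto
    also have "\<dots> \<le> n" using f(2) ij by auto
    finally show "P (f (N i)) n" by (rule h[OF f(1)])
  qed (rule f(1))
qed

text \<open>Layers have an abstract type because they occur in two forms: a single level, and a
  finite family of labelled cylinders. \<open>M\<close> is prescribed by the caller since in the
  second form \<open>good\<close> contains a bound that depends on \<open>M\<close>. The layers are
  fixed before \<open>E\<close>, so only finitely many shapes matter when \<open>n\<close> is taken
  large, uniformly in the assignment \<nu>.\<close>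

lemma (in group) folner_quasi_tiling:
  fixes T D :: "nat \<Rightarrow> 'a set" and lev :: "'q \<Rightarrow> nat set" and C \<epsilon> \<eta> \<kappa> :: real
  assumes T: "folner_sequence G T"
    and D: "\<And>n. finite (D n)" "\<And>n. D n \<subseteq> carrier G" "\<And>n. real (card (D n)) \<le> C * real (card (T n))"
    and C: "C \<ge> 0" and \<epsilon>: "0 < \<epsilon>" "\<epsilon> \<le> 1 / 2" and \<eta>: "\<eta> > 0"
    and M: "(1 - 1 / (1 / \<epsilon> + C / (1 - \<epsilon>))) ^ M \<le> \<eta> / 2"
    and good: "\<And>N. \<exists>q. good q \<and> (\<forall>n\<in>lev q. N \<le> n)" "\<And>q. good q \<Longrightarrow> finite (lev q)"
    and TD: "\<And>q k m g. good q \<Longrightarrow> k \<in> lev q \<Longrightarrow> m \<in> lev q \<Longrightarrow> k < m \<Longrightarrow> g \<in> carrier G \<Longrightarrow>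
      (T k #> g) \<inter> T m \<noteq> {} \<Longrightarrow> g \<in> D m"
  obtains Q :: "nat \<Rightarrow> 'q" where "\<And>j. good (Q j)"
    "\<And>E. folner_sequence G E \<Longrightarrow> eventually (\<lambda>n. \<forall>\<nu>. (\<forall>j<M. \<forall>c\<in>E n. \<nu> j c \<in> lev (Q j)) \<longrightarrow>
      (\<exists>S. S \<subseteq> {..<M} \<times> E n \<and> (\<forall>p\<in>S. T (\<nu> (fst p) (snd p)) #> snd p \<subseteq> E n) \<and>
        (1 - \<epsilon>) * (\<Sum>p\<in>S. real (card (T (\<nu> (fst p) (snd p))))) \<le> real (card (E n)) \<and>
        real (card (E n - (\<Union>p\<in>S. T (\<nu> (fst p) (snd p)) #> snd p))) \<le> \<eta> * real (card (E n)))) sequentially"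
proof -
  \<comment> \<open>The term \<open>3 * \<delta>\<close> takes one half of \<eta>; the power bounded
    in assumption \<open>M\<close> takes the other.\<close>
  define \<delta> where "\<delta> = \<eta> / 6"
  have T': "\<And>n. finite (T n)" "\<And>n. T n \<noteq> {}" "\<And>n. T n \<subseteq> carrier G"
    using T by (auto simp: folner_sequence_def)
  define K where "K q = (\<Union>k\<in>lev q. T k)" for q
  have K: "finite (K q)" "K q \<subseteq> carrier G" if "good q" for q
    using good(2)[OF that] T' by (auto simp: K_def)
  have \<delta>: "\<delta> > 0" using \<eta> by (simp add: \<delta>_def)
  define P where "P q n \<longleftrightarrow> real (card (bdry G (K q) (T n))) \<le> \<delta> * real (card (T n))" for q n
  have evP: "eventually (P q) sequentially" if "good q" for q
    unfolding P_def using folner_bdry[OF T K[OF that] \<delta>] .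
  obtain R :: "nat \<Rightarrow> 'q" where R: "\<And>j. good (R j)" "\<And>i j n. i < j \<Longrightarrow> n \<in> lev (R j) \<Longrightarrow> P (R i) n"
  proof (rule exists_layer_sequence[of good lev P, OF good(1) evP])
    fix Q :: "nat \<Rightarrow> 'q"
    assume "\<And>j. good (Q j)" "\<And>i j n. i < j \<Longrightarrow> n \<in> lev (Q j) \<Longrightarrow> P (Q i) n"
    then show thesis by (rule that[of Q])
  qed
  \<comment> \<open>\<open>R\<close> proceeds from small levels to large ones, whereas the tiling
    has to place the large tiles first.\<close>
  define Q where "Q j = R (M - 1 - j)" for j
  show thesis
  proof (rule that[of Q])
    show "good (Q j)" for j by (simp add: Q_def R)
    fix E assume E: "folner_sequence G E"
    then have E': "\<And>n. finite (E n)" "\<And>n. E n \<subseteq> carrier G" by (auto simp: folner_sequence_def)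
    have "eventually (\<lambda>n. \<forall>j\<in>{..<M}. real (card (bdry G (K (Q j)) (E n))) \<le> \<delta> * real (card (E n))) sequentially"
      by (intro eventually_ball_finite ballI folner_bdry[OF E K \<delta>]) (auto simp: Q_def R)
    then show "eventually (\<lambda>n. \<forall>\<nu>. (\<forall>j<M. \<forall>c\<in>E n. \<nu> j c \<in> lev (Q j)) \<longrightarrow>
      (\<exists>S. S \<subseteq> {..<M} \<times> E n \<and> (\<forall>p\<in>S. T (\<nu> (fst p) (snd p)) #> snd p \<subseteq> E n) \<and>
        (1 - \<epsilon>) * (\<Sum>p\<in>S. real (card (T (\<nu> (fst p) (snd p))))) \<le> real (card (E n)) \<and>
        real (card (E n - (\<Union>p\<in>S. T (\<nu> (fst p) (snd p)) #> snd p))) \<le> \<eta> * real (card (E n)))) sequentially"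
    proof (eventually_elim, intro allI impI)
      fix n \<nu>
      assume n: "\<forall>j\<in>{..<M}. real (card (bdry G (K (Q j)) (E n))) \<le> \<delta> * real (card (E n))"
        and \<nu>: "\<forall>j<M. \<forall>c\<in>E n. \<nu> j c \<in> lev (Q j)"
      let ?\<kappa> = "1 / (1 / \<epsilon> + C / (1 - \<epsilon>))"
      have "\<exists>S. S \<subseteq> {..<M} \<times> E n \<and> (\<forall>p\<in>S. T (\<nu> (fst p) (snd p)) #> snd p \<subseteq> E n) \<and>
        (1 - \<epsilon>) * (\<Sum>p\<in>S. real (card (T (\<nu> (fst p) (snd p))))) \<le>
          real (card (\<Union>p\<in>S. T (\<nu> (fst p) (snd p)) #> snd p)) \<and>
        real (card (E n - (\<Union>p\<in>S. T (\<nu> (fst p) (snd p)) #> snd p))) \<le> ((1 - ?\<kappa>) ^ M + 3 * \<delta>) * real (card (E n))"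
      proof (rule exists_quasi_tiling[OF T' D C E' \<epsilon> less_imp_le[OF \<delta>] refl, where I = "\<lambda>j. lev (Q j)"], goal_cases)
        case (1 j) show ?case using good(2) R(1) by (simp add: Q_def)
      next
        case (2 j c) then show ?case using \<nu> by auto
      next
        case (3 j k m g) show ?case by (rule TD[of "Q j" k m]) (use 3 R(1) in \<open>auto simp: Q_def\<close>)
      next
        case (4 i j m)
        then have "P (Q j) m" unfolding Q_def by (intro R(2)[of "M - 1 - j" "M - 1 - i"]) (auto simp: Q_def)
        then show ?case by (simp add: P_def K_def)
      next
        case (5 j) then show ?case using n by (auto simp: K_def)
      qed
      then obtain S where S: "S \<subseteq> {..<M} \<times> E n" "\<forall>p\<in>S. T (\<nu> (fst p) (snd p)) #> snd p \<subseteq> E n"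
        "(1 - \<epsilon>) * (\<Sum>p\<in>S. real (card (T (\<nu> (fst p) (snd p))))) \<le>
          real (card (\<Union>p\<in>S. T (\<nu> (fst p) (snd p)) #> snd p))"
        "real (card (E n - (\<Union>p\<in>S. T (\<nu> (fst p) (snd p)) #> snd p))) \<le> ((1 - ?\<kappa>) ^ M + 3 * \<delta>) * real (card (E n))"
        by blast
      have "card (\<Union>p\<in>S. T (\<nu> (fst p) (snd p)) #> snd p) \<le> card (E n)"
        using S(2) E' by (intro card_mono) auto
      then have "(1 - \<epsilon>) * (\<Sum>p\<in>S. real (card (T (\<nu> (fst p) (snd p))))) \<le> real (card (E n))"
        using S(3) by linarith
      moreover have "((1 - ?\<kappa>) ^ M + 3 * \<delta>) * real (card (E n)) \<le> \<eta> * real (card (E n))"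
        using M by (intro mult_right_mono) (auto simp: \<delta>_def)
      ultimately show "\<exists>S. S \<subseteq> {..<M} \<times> E n \<and> (\<forall>p\<in>S. T (\<nu> (fst p) (snd p)) #> snd p \<subseteq> E n) \<and>
        (1 - \<epsilon>) * (\<Sum>p\<in>S. real (card (T (\<nu> (fst p) (snd p))))) \<le> real (card (E n)) \<and>
        real (card (E n - (\<Union>p\<in>S. T (\<nu> (fst p) (snd p)) #> snd p))) \<le> \<eta> * real (card (E n))"
        using S(1,2,4) by (intro exI[of _ S]) auto
    qed
  qed
qed

section \<open>The Ornstein--Weiss lemma\<close>

text \<open>Almost disjoint sets may have total size \<open>1 / (1 - \<epsilon>)\<close> times that
  of the ambient set; here \<epsilon> is chosen so that this raises a rate \<open>a\<close> by at
  most \<xi>. The value \<open>\<xi> / (a + \<xi>)\<close> solves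
  \<open>(a + \<xi>) * (1 - \<epsilon>) = a\<close>.\<close>

lemma ex_inflation_factor:
  fixes a \<xi> :: real
  assumes "a \<ge> 0" "\<xi> > 0"
  obtains \<epsilon> where "0 < \<epsilon>" "\<epsilon> \<le> 1 / 2" "a / (1 - \<epsilon>) \<le> a + \<xi>"
proof -
  define \<epsilon> where "\<epsilon> = min (1 / 2) (\<xi> / (a + \<xi>))"
  have \<epsilon>: "0 < \<epsilon>" using assms by (simp add: \<epsilon>_def)
  have \<epsilon>2: "\<epsilon> \<le> 1 / 2" unfolding \<epsilon>_def by (rule min.cobounded1)
  have "\<epsilon> * (a + \<xi>) \<le> (\<xi> / (a + \<xi>)) * (a + \<xi>)"
    using assms by (intro mult_right_mono) (auto simp: \<epsilon>_def)
  also have "\<dots> = \<xi>" using assms by simp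
  finally have "a \<le> (a + \<xi>) * (1 - \<epsilon>)" by (simp add: algebra_simps)
  then have "a / (1 - \<epsilon>) \<le> a + \<xi>" using \<epsilon>2 by (simp add: pos_divide_le_eq)
  with \<epsilon> \<epsilon>2 show thesis by (rule that)
qed

lemma ex_layer_count:
  fixes C \<epsilon> \<eta> :: real
  assumes "0 < \<epsilon>" "\<epsilon> \<le> 1 / 2" "C \<ge> 0" "\<eta> > 0"
  obtains M where "(1 - 1 / (1 / \<epsilon> + C / (1 - \<epsilon>))) ^ M \<le> \<eta> / 2"
proof -
  have "1 / \<epsilon> + C / (1 - \<epsilon>) > 0" using assms by (intro add_pos_nonneg) auto
  then have "1 - 1 / (1 / \<epsilon> + C / (1 - \<epsilon>)) < 1" by simp
  then obtain M where "(1 - 1 / (1 / \<epsilon> + C / (1 - \<epsilon>))) ^ M < \<eta> / 2"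
    using real_arch_pow_inv[of "\<eta> / 2"] assms(4) half_gt_zero by blast
  then show thesis using that[of M] by simp
qed

section \<open>Subadditive functions of finite sets under right translation\<close>

locale subadditive_invariant = group G for G (structure) +
  fixes f :: "'a set \<Rightarrow> real"
  assumes nonneg: "\<And>E. finite E \<Longrightarrow> E \<subseteq> carrier G \<Longrightarrow> 0 \<le> f E"
    and f_empty: "f {} = 0"
    and subadd: "\<And>E F. finite E \<Longrightarrow> E \<subseteq> carrier G \<Longrightarrow> finite F \<Longrightarrow> F \<subseteq> carrier G \<Longrightarrow> f (E \<union> F) \<le> f E + f F"
    and r_invariant: "\<And>E c. finite E \<Longrightarrow> E \<subseteq> carrier G \<Longrightarrow> c \<in> carrier G \<Longrightarrow> f (E #> c) \<le> f E"
begin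

lemma subadd_UN:
  assumes "finite S" "\<And>p. p \<in> S \<Longrightarrow> finite (t p)" "\<And>p. p \<in> S \<Longrightarrow> t p \<subseteq> carrier G"
  shows "f (\<Union>p\<in>S. t p) \<le> (\<Sum>p\<in>S. f (t p))"
  using assms
proof (induction S rule: finite_induct)
  case empty
  show ?case by (simp add: f_empty)
next
  case (insert p S)
  have "f (t p \<union> (\<Union>q\<in>S. t q)) \<le> f (t p) + f (\<Union>q\<in>S. t q)"
    using insert.prems insert.hyps by (intro subadd) auto
  moreover have "f (\<Union>q\<in>S. t q) \<le> (\<Sum>q\<in>S. f (t q))" using insert.prems by (intro insert.IH) auto
  ultimately show ?case using insert.hyps by simp
qed

lemma le_card:
  assumes "finite E" "E \<subseteq> carrier G"
  shows "f E \<le> real (card E) * f {\<one>}"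
proof -
  have "f E = f (\<Union>g\<in>E. {g})" by simp
  also have "\<dots> \<le> (\<Sum>g\<in>E. f {g})" using assms by (intro subadd_UN) auto
  also have "\<dots> \<le> (\<Sum>g\<in>E. f {\<one>})"
  proof (rule sum_mono)
    fix g assume "g \<in> E"
    then have "{\<one>} #> g = {g}" "g \<in> carrier G" using assms by (auto simp: r_coset_def)
    then show "f {g} \<le> f {\<one>}" using r_invariant[of "{\<one>}" g] by simp
  qed
  finally show ?thesis by simp
qed

text \<open>\<open>E n\<close> is quasi-tiled by sets \<open>T k\<close> of ratio at most
  \<open>a\<close>. With one shape per layer no two levels compete, hence \<open>D\<close> is empty
  and the constant is 0. The overlaps cost \<xi>, and the uncovered part, estimated by its size
  times \<open>f {\<one>}\<close>, costs another \<xi>; both fit into the gap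
  \<open>b - a = 4 * \<xi>\<close>.\<close>

lemma folner_ratio_less:
  assumes T: "folner_sequence G T" and E: "folner_sequence G E"
    and fr: "frequently (\<lambda>n. f (T n) / real (card (T n)) < a) sequentially" and ab: "a < b"
  shows "eventually (\<lambda>n. f (E n) / real (card (E n)) < b) sequentially"
proof -
  have T': "\<And>n. finite (T n)" "\<And>n. T n \<noteq> {}" "\<And>n. T n \<subseteq> carrier G"
    using T by (auto simp: folner_sequence_def)
  have E': "\<And>n. finite (E n)" "\<And>n. E n \<noteq> {}" "\<And>n. E n \<subseteq> carrier G"
    using E by (auto simp: folner_sequence_def)
  obtain n0 where "f (T n0) / real (card (T n0)) < a" using fr frequently_ex by blast
  moreover have "0 \<le> f (T n0) / real (card (T n0))" using nonneg T' by simp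
  ultimately have a: "a > 0" by linarith
  define f1 where "f1 = f {\<one>}"
  have f1: "f1 \<ge> 0" by (auto simp: f1_def nonneg)
  define \<xi> where "\<xi> = (b - a) / 4"
  have \<xi>: "\<xi> > 0" using ab by (simp add: \<xi>_def)
  obtain \<epsilon> where \<epsilon>: "0 < \<epsilon>" "\<epsilon> \<le> 1 / 2" "a / (1 - \<epsilon>) \<le> a + \<xi>"
    using ex_inflation_factor[of a \<xi>] a \<xi> by auto
  define \<eta> where "\<eta> = \<xi> / (f1 + 1)"
  have \<eta>: "\<eta> > 0" "\<eta> * f1 \<le> \<xi>" using f1 \<xi> by (auto simp: \<eta>_def field_simps)
  obtain M where M: "(1 - 1 / (1 / \<epsilon> + 0 / (1 - \<epsilon>))) ^ M \<le> \<eta> / 2"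
    using ex_layer_count[OF \<epsilon>(1,2) order_refl \<eta>(1)] by blast
  define good where "good n \<longleftrightarrow> f (T n) \<le> a * real (card (T n))" for n
  have ex: "\<exists>n. good n \<and> (\<forall>k\<in>{n}. N \<le> k)" for N
  proof -
    obtain n where "n \<ge> N" "f (T n) / real (card (T n)) < a"
      using fr unfolding frequently_sequentially by blast
    moreover have "card (T n) > 0" using T' by (simp add: card_gt_0_iff)
    ultimately show ?thesis by (intro exI[of _ n]) (auto simp: good_def divide_less_eq)
  qed
  obtain Q :: "nat \<Rightarrow> nat" where Q: "\<And>j. good (Q j)" and ev:
    "eventually (\<lambda>n. \<forall>\<nu>. (\<forall>j<M. \<forall>c\<in>E n. \<nu> j c \<in> {Q j}) \<longrightarrow>
      (\<exists>S. S \<subseteq> {..<M} \<times> E n \<and> (\<forall>p\<in>S. T (\<nu> (fst p) (snd p)) #> snd p \<subseteq> E n) \<and>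
        (1 - \<epsilon>) * (\<Sum>p\<in>S. real (card (T (\<nu> (fst p) (snd p))))) \<le> real (card (E n)) \<and>
        real (card (E n - (\<Union>p\<in>S. T (\<nu> (fst p) (snd p)) #> snd p))) \<le> \<eta> * real (card (E n)))) sequentially"
  proof (rule folner_quasi_tiling[OF T _ _ _ order_refl \<epsilon>(1,2) \<eta>(1) M, where D = "\<lambda>_. {}" and lev = "\<lambda>n. {n}", OF _ _ _ ex], goal_cases)
    case (6 Q) show ?case by (rule 6(1)[of Q, OF 6(2) 6(3)[OF E]])
  qed auto
  from ev show ?thesis
  proof (rule eventually_mono)
    fix n
    assume tiling: "\<forall>\<nu>. (\<forall>j<M. \<forall>c\<in>E n. \<nu> j c \<in> {Q j}) \<longrightarrow>
      (\<exists>S. S \<subseteq> {..<M} \<times> E n \<and> (\<forall>p\<in>S. T (\<nu> (fst p) (snd p)) #> snd p \<subseteq> E n) \<and>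
        (1 - \<epsilon>) * (\<Sum>p\<in>S. real (card (T (\<nu> (fst p) (snd p))))) \<le> real (card (E n)) \<and>
        real (card (E n - (\<Union>p\<in>S. T (\<nu> (fst p) (snd p)) #> snd p))) \<le> \<eta> * real (card (E n)))"
    obtain S where S: "S \<subseteq> {..<M} \<times> E n" "\<forall>p\<in>S. T (Q (fst p)) #> snd p \<subseteq> E n"
      "(1 - \<epsilon>) * (\<Sum>p\<in>S. real (card (T (Q (fst p))))) \<le> real (card (E n))"
      "real (card (E n - (\<Union>p\<in>S. T (Q (fst p)) #> snd p))) \<le> \<eta> * real (card (E n))"
      using tiling[rule_format, of "\<lambda>j _. Q j"] by auto
    define U where "U = (\<Union>p\<in>S. T (Q (fst p)) #> snd p)"
    have UE: "U \<subseteq> E n" using S(2) by (auto simp: U_def)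
    have finS: "finite S" using S(1) E' by (meson finite_SigmaI finite_lessThan finite_subset)
    have sndS: "snd p \<in> carrier G" if "p \<in> S" for p using that S(1) E'(3)[of n] by force
    have ne: "real (card (E n)) > 0" using E' by (simp add: card_gt_0_iff)
    have "f U \<le> (\<Sum>p\<in>S. f (T (Q (fst p)) #> snd p))"
      unfolding U_def
    proof (rule subadd_UN[OF finS])
      show "T (Q (fst p)) #> snd p \<subseteq> carrier G" if "p \<in> S" for p
        using that S(2) E'(3)[of n] by blast
    qed (use T' in \<open>simp add: finite_r_coset\<close>)
    also have "\<dots> \<le> (\<Sum>p\<in>S. a * real (card (T (Q (fst p)))))"
    proof (rule sum_mono)
      fix p assume "p \<in> S"
      then have "f (T (Q (fst p)) #> snd p) \<le> f (T (Q (fst p)))"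
        using T' sndS by (intro r_invariant) auto
      also have "\<dots> \<le> a * real (card (T (Q (fst p))))" using Q by (simp add: good_def)
      finally show "f (T (Q (fst p)) #> snd p) \<le> a * real (card (T (Q (fst p))))" .
    qed
    also have "\<dots> = a * (\<Sum>p\<in>S. real (card (T (Q (fst p)))))" by (simp add: sum_distrib_left)
    also have "\<dots> \<le> a * (real (card (E n)) / (1 - \<epsilon>))"
      using S(3) a \<epsilon> by (intro mult_left_mono) (auto simp: field_simps)
    also have "\<dots> = (a / (1 - \<epsilon>)) * real (card (E n))" by simp
    also have "\<dots> \<le> (a + \<xi>) * real (card (E n))" using \<epsilon> by (intro mult_right_mono) auto
    finally have 1: "f U \<le> (a + \<xi>) * real (card (E n))" .
    have "f (E n - U) \<le> real (card (E n - U)) * f1"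
      unfolding f1_def using E'(1) E'(3)[of n] by (intro le_card) auto
    also have "\<dots> \<le> (\<eta> * real (card (E n))) * f1"
      using S(4) f1 by (intro mult_right_mono) (auto simp: U_def)
    also have "\<dots> = (\<eta> * f1) * real (card (E n))" by simp
    also have "\<dots> \<le> \<xi> * real (card (E n))" using \<eta> by (intro mult_right_mono) auto
    finally have 2: "f (E n - U) \<le> \<xi> * real (card (E n))" .
    have "f (U \<union> (E n - U)) \<le> f U + f (E n - U)"
      using UE E'(1)[of n] E'(3)[of n] finite_subset[OF UE] by (intro subadd) auto
    moreover have "U \<union> (E n - U) = E n" using UE by auto
    ultimately have "f (E n) \<le> (a + 2 * \<xi>) * real (card (E n))" using 1 2 by (simp add: algebra_simps)
    also have "\<dots> < b * real (card (E n))" using ne ab by (intro mult_strict_right_mono) (auto simp: \<xi>_def field_simps)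
    finally show "f (E n) / real (card (E n)) < b" using ne by (simp add: divide_less_eq)
  qed
qed

text \<open>\<open>Inf Z\<close> is the lower limit of the ratios along \<open>T\<close>. By
  \<open>folner_ratio_less\<close> it bounds the upper limit along every \<open>E\<close>; with
  \<open>E\<close> and \<open>T\<close> exchanged, the same lemma shows that \<open>E\<close> cannot
  fall below it infinitely often. Unique existence is the form that the definite description in
  \<open>cover_entropy\<close> requires.\<close>

theorem ornstein_weiss:
  assumes "amenable G"
  shows "\<exists>!L. \<forall>F. folner_sequence G F \<longrightarrow> (\<lambda>n. f (F n) / real (card (F n))) \<longlonglongrightarrow> L"
proof -
  obtain T where T: "folner_sequence G T" using assms by (auto simp: amenable_def)
  define u where "u E n = f (E n) / real (card (E n))" for E :: "nat \<Rightarrow> 'a set" and n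
  define Z where "Z = {a. frequently (\<lambda>n. u T n < a) sequentially}"
  have u: "0 \<le> u E n" "u E n \<le> f {\<one>}" if "folner_sequence G E" for E n
  proof -
    have E: "finite (E n)" "E n \<noteq> {}" "E n \<subseteq> carrier G" using that by (auto simp: folner_sequence_def)
    then show "0 \<le> u E n" "u E n \<le> f {\<one>}"
      using nonneg[OF E(1,3)] le_card[OF E(1,3)] by (auto simp: u_def divide_le_eq card_gt_0_iff mult.commute)
  qed
  have bdd: "bdd_below Z"
  proof (rule bdd_belowI)
    fix a assume "a \<in> Z"
    then obtain n where "u T n < a" using frequently_ex by (auto simp: Z_def)
    then show "0 \<le> a" using u(1)[OF T, of n] by simp
  qed
  have "f {\<one>} + 1 \<in> Z"
    unfolding Z_def by (simp, rule eventually_frequently) (auto intro!: always_eventually le_less_trans[OF u(2)[OF T]])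
  then have ne: "Z \<noteq> {}" by auto
  have lim: "u E \<longlonglongrightarrow> Inf Z" if E: "folner_sequence G E" for E
  proof (rule order_tendstoI)
    fix b assume "Inf Z < b"
    then obtain a where "a \<in> Z" "a < b" using cInf_less_iff[OF ne bdd] by blast
    then show "eventually (\<lambda>n. u E n < b) sequentially"
      using folner_ratio_less[OF T E, of a b] by (simp add: Z_def u_def)
  next
    fix b assume b: "b < Inf Z"
    show "eventually (\<lambda>n. b < u E n) sequentially"
    proof (rule ccontr)
      assume "\<not> ?thesis"
      then have "frequently (\<lambda>n. \<not> b < u E n) sequentially" by (simp add: frequently_def)
      \<comment> \<open>With I = \<open>Inf Z\<close>, two thresholds are placed strictly between b
        and I: b < (2b + I)/3 < (b + I)/2 < I.\<close>
      then have "frequently (\<lambda>n. u E n < (2 * b + Inf Z) / 3) sequentially"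
        by (rule frequently_elim1) (use b in auto)
      then have "eventually (\<lambda>n. u T n < (b + Inf Z) / 2) sequentially"
        using folner_ratio_less[OF E T, of "(2 * b + Inf Z) / 3" "(b + Inf Z) / 2"] b by (simp add: u_def)
      then have "(b + Inf Z) / 2 \<in> Z" by (auto simp: Z_def intro: eventually_frequently)
      then have "Inf Z \<le> (b + Inf Z) / 2" using bdd by (rule cInf_lower)
      then show False using b by simp
    qed
  qed
  show ?thesis
  proof (rule ex1I[of _ "Inf Z"])
    show "\<forall>F. folner_sequence G F \<longrightarrow> (\<lambda>n. f (F n) / real (card (F n))) \<longlonglongrightarrow> Inf Z"
      using lim by (auto simp: u_def[abs_def])
    fix L assume "\<forall>F. folner_sequence G F \<longrightarrow> (\<lambda>n. f (F n) / real (card (F n))) \<longlonglongrightarrow> L"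
    then have "u T \<longlonglongrightarrow> L" using T by (auto simp: u_def[abs_def])
    then show "L = Inf Z" using lim[OF T] LIMSEQ_unique by blast
  qed
qed

end

section \<open>Cover numbers and patterns\<close>

lemma min_subcover_card_le:
  assumes W: "finite W" "X \<subseteq> \<Union>W" and ref: "\<And>w. w \<in> W \<Longrightarrow> \<exists>v\<in>V. w \<inter> X \<subseteq> v"
  shows "min_subcover_card X V \<le> card W"
proof -
  obtain r where r: "\<And>w. w \<in> W \<Longrightarrow> r w \<in> V" "\<And>w. w \<in> W \<Longrightarrow> w \<inter> X \<subseteq> r w"
    using ref by metis
  have "X \<subseteq> \<Union>(r ` W)" using W(2) r(2) by blast
  then have "min_subcover_card X V \<le> card (r ` W)"
    unfolding min_subcover_card_def using W r by (intro Least_le exI[of _ "r ` W"]) auto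
  also have "\<dots> \<le> card W" using W by (intro card_image_le)
  finally show ?thesis .
qed

lemma min_subcover_card_attained:
  assumes "finite V" "X \<subseteq> \<Union>V"
  obtains W where "W \<subseteq> V" "finite W" "X \<subseteq> \<Union>W" "card W = min_subcover_card X V"
proof -
  have "\<exists>W\<subseteq>V. finite W \<and> X \<subseteq> \<Union>W \<and> card W = min_subcover_card X V"
    unfolding min_subcover_card_def
    by (rule LeastI_ex) (use assms in blast)
  then show thesis using that by blast
qed

definition patterns :: "('g \<Rightarrow> 'a) set \<Rightarrow> 'g set \<Rightarrow> ('g \<Rightarrow> 'a) set" where
  "patterns X E = (\<lambda>x. restrict x E) ` X"

lemma restrict_eq_iff: "restrict x E = restrict y E \<longleftrightarrow> (\<forall>g\<in>E. x g = y g)"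
  by (metis restrict_apply' restrict_ext)

lemma shift_apply: "g \<in> carrier G \<Longrightarrow> shift G h x g = x (g \<otimes>\<^bsub>G\<^esub> h)"
  by (simp add: shift_def)

lemma (in group) shift_shift:
  "g \<in> carrier G \<Longrightarrow> c \<in> carrier G \<Longrightarrow> shift G g (shift G c x) = shift G (g \<otimes> c) x"
  by (auto simp: shift_def m_assoc)

section \<open>Compactness and patterns of the subshift\<close>

locale finite_subshift = group G for G (structure) +
  fixes A :: "'b set" and X :: "('a \<Rightarrow> 'b) set"
  assumes finite_A: "finite A" and subshift: "subshift G A X"
begin

lemma topspace_full_shift: "topspace (full_shift G A) = (carrier G \<rightarrow>\<^sub>E A)"
  by (simp add: full_shift_def)

lemma X_subset: "X \<subseteq> carrier G \<rightarrow>\<^sub>E A"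
  using subshift closedin_subset topspace_full_shift by (metis subshift_def)

lemma X_apply: "x \<in> X \<Longrightarrow> g \<in> carrier G \<Longrightarrow> x g \<in> A"
  using X_subset by auto

lemma shift_in_X: "h \<in> carrier G \<Longrightarrow> x \<in> X \<Longrightarrow> shift G h x \<in> X"
  using subshift by (auto simp: subshift_def)

lemma compactin_X: "compactin (full_shift G A) X"
proof (rule closedin_compact_space)
  show "compact_space (full_shift G A)"
    using finite_A by (simp add: full_shift_def compact_space_product_topology compact_space_discrete_topology)
qed (use subshift in \<open>simp add: subshift_def\<close>)

lemma openin_cylinder:
  assumes "finite E" "E \<subseteq> carrier G"
  shows "openin (full_shift G A) {x \<in> carrier G \<rightarrow>\<^sub>E A. \<forall>g\<in>E. x g = y g}"
proof -
  have eq: "{x \<in> carrier G \<rightarrow>\<^sub>E A. \<forall>g\<in>E. x g = y g} =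
      PiE (carrier G) (\<lambda>g. if g \<in> E then {y g} \<inter> A else A)"
  proof (intro equalityI subsetI)
    fix x assume "x \<in> PiE (carrier G) (\<lambda>g. if g \<in> E then {y g} \<inter> A else A)"
    then have x: "x \<in> extensional (carrier G)"
      and xg: "\<And>g. g \<in> carrier G \<Longrightarrow> x g \<in> (if g \<in> E then {y g} \<inter> A else A)"
      by (auto simp: PiE_iff)
    have "x g \<in> A" if "g \<in> carrier G" for g using xg[OF that] by (cases "g \<in> E") auto
    moreover have "x g = y g" if "g \<in> E" for g using xg[of g] that assms(2) by auto
    ultimately show "x \<in> {x \<in> carrier G \<rightarrow>\<^sub>E A. \<forall>g\<in>E. x g = y g}"
      using x by (auto simp: PiE_iff)
  qed (use assms(2) in \<open>auto simp: PiE_iff\<close>)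
  have "finite {g \<in> carrier G. (if g \<in> E then {y g} \<inter> A else A) \<noteq> topspace (discrete_topology A)}"
    by (rule finite_subset[OF _ assms(1)]) auto
  then show ?thesis
    unfolding eq full_shift_def by (subst openin_PiE_gen) auto
qed

lemma finite_patterns: "finite E \<Longrightarrow> E \<subseteq> carrier G \<Longrightarrow> finite (patterns X E)"
proof -
  assume E: "finite E" "E \<subseteq> carrier G"
  have "patterns X E \<subseteq> (E \<rightarrow>\<^sub>E A)"
    using X_apply E(2) by (auto simp: patterns_def)
  then show ?thesis using E finite_A by (meson finite_PiE finite_subset)
qed

lemma card_patterns_Un_le:
  assumes "finite E" "E \<subseteq> carrier G" "finite F" "F \<subseteq> carrier G"
  shows "card (patterns X (E \<union> F)) \<le> card (patterns X E) * card A ^ card F"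
proof -
  let ?r = "\<lambda>p. (restrict p E, restrict p F)"
  have "inj_on ?r (patterns X (E \<union> F))"
  proof (rule inj_onI)
    fix p q assume "p \<in> patterns X (E \<union> F)" "q \<in> patterns X (E \<union> F)" and eq: "?r p = ?r q"
    then obtain x y where xy: "p = restrict x (E \<union> F)" "q = restrict y (E \<union> F)"
      by (auto simp: patterns_def)
    have "\<forall>g\<in>E. p g = q g" "\<forall>g\<in>F. p g = q g"
      using eq by (auto simp: restrict_eq_iff)
    then show "p = q" unfolding xy restrict_eq_iff by auto
  qed
  then have "card (patterns X (E \<union> F)) = card (?r ` patterns X (E \<union> F))" by (simp add: card_image)
  also have "\<dots> \<le> card (patterns X E \<times> (F \<rightarrow>\<^sub>E A))"
  proof (rule card_mono)
    show "finite (patterns X E \<times> (F \<rightarrow>\<^sub>E A))"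
      using assms finite_A by (intro finite_cartesian_product finite_patterns finite_PiE) auto
    show "?r ` patterns X (E \<union> F) \<subseteq> patterns X E \<times> (F \<rightarrow>\<^sub>E A)"
    proof (intro image_subsetI)
      fix p assume "p \<in> patterns X (E \<union> F)"
      then obtain x where x: "x \<in> X" "p = restrict x (E \<union> F)" by (auto simp: patterns_def)
      have "restrict p E = restrict x E" by (auto simp: x restrict_def)
      moreover have "restrict p F \<in> F \<rightarrow>\<^sub>E A" using X_apply[OF x(1)] assms by (auto simp: x)
      ultimately show "?r p \<in> patterns X E \<times> (F \<rightarrow>\<^sub>E A)"
        using x by (auto simp: patterns_def)
    qed
  qed
  also have "\<dots> = card (patterns X E) * card A ^ card F"
    using assms by (simp add: card_cartesian_product card_PiE)
  finally show ?thesis .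
qed

end

section \<open>Cover numbers of joins\<close>

locale covered_subshift = finite_subshift G A X for G (structure) and A :: "'b set" and X +
  fixes \<U>
  assumes cover: "\<U> \<in> finite_open_covers (full_shift G A) X"
begin

abbreviation N where "N F \<equiv> min_subcover_card X (join_cover G X \<U> F)"

lemma finite_cover: "finite \<U>" "\<Union>\<U> = X" "\<And>U. U \<in> \<U> \<Longrightarrow> openin (subtopology (full_shift G A) X) U"
  using cover by (auto simp: finite_open_covers_def)

lemma finite_join_cover:
  assumes "finite F"
  shows "finite (join_cover G X \<U> F)"
proof -
  have "join_cover G X \<U> F \<subseteq> (\<lambda>U. \<Inter>g\<in>F. {x \<in> X. shift G g x \<in> U g}) ` (F \<rightarrow>\<^sub>E \<U>)"
  proof
    fix w assume "w \<in> join_cover G X \<U> F"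
    then obtain U where U: "U \<in> F \<rightarrow> \<U>" "w = (\<Inter>g\<in>F. {x \<in> X. shift G g x \<in> U g})"
      by (auto simp: join_cover_def)
    then have "w = (\<Inter>g\<in>F. {x \<in> X. shift G g x \<in> restrict U F g})" by auto
    moreover have "restrict U F \<in> F \<rightarrow>\<^sub>E \<U>" using U by auto
    ultimately show "w \<in> (\<lambda>U. \<Inter>g\<in>F. {x \<in> X. shift G g x \<in> U g}) ` (F \<rightarrow>\<^sub>E \<U>)" by blast
  qed
  then show ?thesis using finite_cover(1) assms by (meson finite_PiE finite_imageI finite_subset)
qed

lemma join_cover_covers:
  assumes "F \<subseteq> carrier G"
  shows "X \<subseteq> \<Union>(join_cover G X \<U> F)"
proof
  fix x assume x: "x \<in> X"
  have "\<forall>g\<in>F. \<exists>U. U \<in> \<U> \<and> shift G g x \<in> U"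
    using x shift_in_X assms finite_cover(2) by blast
  then obtain U where U: "\<And>g. g \<in> F \<Longrightarrow> U g \<in> \<U> \<and> shift G g x \<in> U g" by metis
  then have "(\<Inter>g\<in>F. {x \<in> X. shift G g x \<in> U g}) \<in> join_cover G X \<U> F"
    by (auto simp: join_cover_def)
  moreover have "x \<in> (\<Inter>g\<in>F. {x \<in> X. shift G g x \<in> U g})" using U x by auto
  ultimately show "x \<in> \<Union>(join_cover G X \<U> F)" by blast
qed

lemma N_attained:
  assumes "finite F" "F \<subseteq> carrier G"
  obtains W where "W \<subseteq> join_cover G X \<U> F" "finite W" "X \<subseteq> \<Union>W" "card W = N F"
  using min_subcover_card_attained[OF finite_join_cover join_cover_covers] assms by blast

lemma N_pos:
  assumes "finite F" "F \<subseteq> carrier G" "X \<noteq> {}"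
  shows "N F > 0"
proof -
  obtain W where "finite W" "X \<subseteq> \<Union>W" "card W = N F" using N_attained[OF assms(1,2)] .
  moreover from this have "W \<noteq> {}" using assms by auto
  ultimately show ?thesis by (metis card_gt_0_iff)
qed

lemma N_Un_le:
  assumes E: "finite E" "E \<subseteq> carrier G" and F: "finite F" "F \<subseteq> carrier G"
  shows "N (E \<union> F) \<le> N E * N F"
proof -
  obtain V where V: "V \<subseteq> join_cover G X \<U> E" "finite V" "X \<subseteq> \<Union>V" "card V = N E"
    using N_attained[OF E] .
  obtain W where W: "W \<subseteq> join_cover G X \<U> F" "finite W" "X \<subseteq> \<Union>W" "card W = N F"
    using N_attained[OF F] .
  let ?VW = "(\<lambda>(v, w). v \<inter> w) ` (V \<times> W)"
  have "N (E \<union> F) \<le> card ?VW"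
  proof (rule min_subcover_card_le)
    show "X \<subseteq> \<Union>?VW" using V(3) W(3) by fastforce
    fix u assume "u \<in> ?VW"
    then obtain v w where vw: "v \<in> V" "w \<in> W" "u = v \<inter> w" by auto
    obtain S where S: "S \<in> E \<rightarrow> \<U>" "v = (\<Inter>g\<in>E. {x \<in> X. shift G g x \<in> S g})"
      using vw V(1) unfolding join_cover_def by blast
    obtain T where T: "T \<in> F \<rightarrow> \<U>" "w = (\<Inter>g\<in>F. {x \<in> X. shift G g x \<in> T g})"
      using vw W(1) unfolding join_cover_def by blast
    \<comment> \<open>On the intersection of \<open>E\<close> and \<open>F\<close> only the
      constraint from \<open>S\<close> is kept; dropping the one from \<open>T\<close> can only
      enlarge the set.\<close>
    define R where "R g = (if g \<in> E then S g else T g)" for g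
    have "(\<Inter>g\<in>E \<union> F. {x \<in> X. shift G g x \<in> R g}) \<in> join_cover G X \<U> (E \<union> F)"
      using S(1) T(1) by (auto simp: join_cover_def R_def Pi_iff)
    moreover have "u \<inter> X \<subseteq> (\<Inter>g\<in>E \<union> F. {x \<in> X. shift G g x \<in> R g})"
      by (auto simp: vw S(2) T(2) R_def)
    ultimately show "\<exists>v\<in>join_cover G X \<U> (E \<union> F). u \<inter> X \<subseteq> v" by blast
  qed (use V W in auto)
  also have "\<dots> \<le> card (V \<times> W)" using V W by (intro card_image_le) auto
  also have "\<dots> = N E * N F" using V W by (simp add: card_cartesian_product)
  finally show ?thesis .
qed

text \<open>A subcover for \<open>F\<close> is pulled back along the shift by \<open>c\<close>:
  shifting by \<open>c\<close> and then by \<open>g\<close> is shifting by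
  \<open>g \<otimes> c\<close>.\<close>

lemma N_r_coset_le:
  assumes F: "finite F" "F \<subseteq> carrier G" and c: "c \<in> carrier G"
  shows "N (F #> c) \<le> N F"
proof -
  obtain W where W: "W \<subseteq> join_cover G X \<U> F" "finite W" "X \<subseteq> \<Union>W" "card W = N F"
    using N_attained[OF F] .
  let ?p = "\<lambda>w. {x \<in> X. shift G c x \<in> w}"
  have "N (F #> c) \<le> card (?p ` W)"
  proof (rule min_subcover_card_le)
    show "X \<subseteq> \<Union>(?p ` W)" using W(3) shift_in_X[OF c] by blast
    fix u assume "u \<in> ?p ` W"
    then obtain w where w: "w \<in> W" "u = ?p w" by auto
    obtain U where U: "U \<in> F \<rightarrow> \<U>" "w = (\<Inter>g\<in>F. {x \<in> X. shift G g x \<in> U g})"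
      using w W(1) unfolding join_cover_def by blast
    define R where "R h = U (h \<otimes> inv c)" for h
    have R: "R (g \<otimes> c) = U g" if "g \<in> F" for g
      using that F c by (auto simp: R_def m_assoc subset_iff)
    have "(\<Inter>h\<in>F #> c. {x \<in> X. shift G h x \<in> R h}) \<in> join_cover G X \<U> (F #> c)"
    proof -
      have "R h \<in> \<U>" if "h \<in> F #> c" for h
        using that U(1) R by (auto simp: r_coset_image)
      then show ?thesis unfolding join_cover_def by blast
    qed
    moreover have "u \<inter> X \<subseteq> (\<Inter>h\<in>F #> c. {x \<in> X. shift G h x \<in> R h})"
    proof (intro subsetI INT_I)
      fix x h assume x: "x \<in> u \<inter> X" and h: "h \<in> F #> c"
      then obtain g where g: "g \<in> F" "h = g \<otimes> c" by (auto simp: r_coset_def)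
      have "shift G g (shift G c x) \<in> U g" using x w(2) U(2) g by auto
      moreover have "shift G g (shift G c x) = shift G h x"
        using shift_shift g F c by auto
      ultimately show "x \<in> {x \<in> X. shift G h x \<in> R h}" using x R g by auto
    qed
    ultimately show "\<exists>v\<in>join_cover G X \<U> (F #> c). u \<inter> X \<subseteq> v" by blast
  qed (use W in auto)
  also have "\<dots> \<le> card W" using W by (intro card_image_le)
  finally show ?thesis using W by simp
qed

lemma N_empty_le: "N {} \<le> 1"
proof -
  \<comment> \<open>The join over the empty set consists of the empty intersection
    \<open>UNIV\<close> alone.\<close>
  have "min_subcover_card X (join_cover G X \<U> {}) \<le> card {UNIV :: ('a \<Rightarrow> 'b) set}"
    by (rule min_subcover_card_le) (auto simp: join_cover_def)
  then show ?thesis by simp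
qed

lemma subadditive_invariant_ln_N: "subadditive_invariant G (\<lambda>F. ln (real (N F)))"
proof
  fix E assume E: "finite E" "E \<subseteq> carrier G"
  show "0 \<le> ln (real (N E))"
    by (cases "N E = 0") auto
next
  show "ln (real (N {})) = 0"
    using N_empty_le by (cases "N {} = 0") (auto simp: le_Suc_eq)
next
  fix E F assume E: "finite E" "E \<subseteq> carrier G" and F: "finite F" "F \<subseteq> carrier G"
  show "ln (real (N (E \<union> F))) \<le> ln (real (N E)) + ln (real (N F))"
  proof (cases "X = {}")
    case True
    have "N H \<le> card ({} :: ('a \<Rightarrow> 'b) set set)" for H
      by (rule min_subcover_card_le) (auto simp: True)
    then show ?thesis by simp
  next
    case False
    have pos: "N E > 0" "N F > 0" "N (E \<union> F) > 0" using N_pos False E F by auto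
    have "ln (real (N (E \<union> F))) \<le> ln (real (N E * N F))"
      using N_Un_le[OF E F] pos by (subst ln_le_cancel_iff) (auto simp del: of_nat_mult)
    also have "\<dots> = ln (real (N E)) + ln (real (N F))" using pos by (simp add: ln_mult)
    finally show ?thesis .
  qed
next
  fix E c assume E: "finite E" "E \<subseteq> carrier G" and c: "c \<in> carrier G"
  show "ln (real (N (E #> c))) \<le> ln (real (N E))"
  proof (cases "N (E #> c) = 0")
    case True
    then show ?thesis by (cases "N E = 0") auto
  next
    case False
    then show ?thesis using N_r_coset_le[OF E c] by (subst ln_le_cancel_iff) auto
  qed
qed

lemma cover_entropy_limit:
  assumes "amenable G" "folner_sequence G F"
  shows "(\<lambda>n. ln (real (N (F n))) / real (card (F n))) \<longlonglongrightarrow> cover_entropy G X \<U>"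
  using theI'[OF subadditive_invariant.ornstein_weiss[OF subadditive_invariant_ln_N assms(1)]] assms(2)
  unfolding cover_entropy_def by blast

text \<open>The finite window \<open>K\<close> plays the role of a Lebesgue number of the cover.\<close>

lemma lebesgue_window:
  obtains K where "finite K" "K \<subseteq> carrier G"
    "\<And>y. y \<in> X \<Longrightarrow> \<exists>U\<in>\<U>. \<forall>x\<in>X. (\<forall>g\<in>K. x g = y g) \<longrightarrow> x \<in> U"
proof -
  have "\<exists>K. finite K \<and> K \<subseteq> carrier G \<and> (\<exists>U\<in>\<U>. \<forall>x\<in>X. (\<forall>g\<in>K. x g = y g) \<longrightarrow> x \<in> U)" if y: "y \<in> X" for y
  proof -
    obtain U where U: "U \<in> \<U>" "y \<in> U" using y finite_cover(2) by blast
    then obtain V where V: "openin (full_shift G A) V" "U = V \<inter> X"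
      using finite_cover(3) by (auto simp: openin_subtopology)
    then obtain B where B: "finite {i \<in> carrier G. B i \<noteq> topspace (discrete_topology A)}"
      "y \<in> PiE (carrier G) B" "PiE (carrier G) B \<subseteq> V"
      using U(2) unfolding full_shift_def openin_product_topology_alt by blast
    \<comment> \<open>A basic open set restricts only finitely many coordinates; these form the
      window of \<open>y\<close>.\<close>
    let ?K = "{i \<in> carrier G. B i \<noteq> A}"
    have "x \<in> U" if x: "x \<in> X" "\<forall>g\<in>?K. x g = y g" for x
    proof -
      have "x g \<in> B g" if "g \<in> carrier G" for g
        using B(2) x X_apply[OF x(1) that] that by (cases "g \<in> ?K") (auto simp: PiE_iff)
      then have "x \<in> PiE (carrier G) B" using X_subset x(1) by (auto simp: PiE_iff)
      then show ?thesis using B(3) V x by auto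
    qed
    then show ?thesis using B(1) U(1) by (intro exI[of _ ?K]) auto
  qed
  then obtain k where k: "\<And>y. y \<in> X \<Longrightarrow> finite (k y)" "\<And>y. y \<in> X \<Longrightarrow> k y \<subseteq> carrier G"
    "\<And>y. y \<in> X \<Longrightarrow> \<exists>U\<in>\<U>. \<forall>x\<in>X. (\<forall>g\<in>k y. x g = y g) \<longrightarrow> x \<in> U" by metis
  define cyl where "cyl y = {x \<in> carrier G \<rightarrow>\<^sub>E A. \<forall>g\<in>k y. x g = y g}" for y
  have "\<forall>C\<in>cyl ` X. openin (full_shift G A) C" unfolding cyl_def using k openin_cylinder by auto
  moreover have "X \<subseteq> \<Union>(cyl ` X)" using X_subset by (auto simp: cyl_def)
  ultimately obtain \<C> where "finite \<C>" "\<C> \<subseteq> cyl ` X" "X \<subseteq> \<Union>\<C>"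
    using compactin_X unfolding compactin_def by meson
  then obtain Y where Y: "Y \<subseteq> X" "finite Y" "X \<subseteq> \<Union>(cyl ` Y)"
    using finite_subset_image by metis
  show thesis
  proof (rule that[of "\<Union>y\<in>Y. k y"])
    fix z assume z: "z \<in> X"
    then obtain y where y: "y \<in> Y" "z \<in> cyl y" using Y by blast
    obtain U where U: "U \<in> \<U>" "\<forall>x\<in>X. (\<forall>g\<in>k y. x g = y g) \<longrightarrow> x \<in> U" using k(3) Y(1) y by blast
    have "\<forall>x\<in>X. (\<forall>g\<in>\<Union> (k ` Y). x g = z g) \<longrightarrow> x \<in> U" using U(2) y by (auto simp: cyl_def)
    then show "\<exists>U\<in>\<U>. \<forall>x\<in>X. (\<forall>g\<in>\<Union> (k ` Y). x g = z g) \<longrightarrow> x \<in> U" using U(1) by blast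
  qed (use Y k in blast)+
qed

text \<open>If two points agree on \<open>K <#> F\<close>, then for each \<open>g\<close> in
  \<open>F\<close> their shifts by \<open>g\<close> agree on \<open>K\<close> and hence lie in a
  common member of the cover. So all points with one pattern on \<open>K <#> F\<close> lie in one
  member of the join.\<close>

lemma N_le_card_patterns:
  assumes K: "\<And>y. y \<in> X \<Longrightarrow> \<exists>U\<in>\<U>. \<forall>x\<in>X. (\<forall>g\<in>K. x g = y g) \<longrightarrow> x \<in> U" "finite K" "K \<subseteq> carrier G"
    and F: "finite F" "F \<subseteq> carrier G"
  shows "N F \<le> card (patterns X (K <#> F))"
proof -
  have KF: "finite (K <#> F)" "K <#> F \<subseteq> carrier G"
    using K F by (auto simp: set_mult_def)
  let ?c = "\<lambda>p. {x \<in> X. restrict x (K <#> F) = p}"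
  have "N F \<le> card (?c ` patterns X (K <#> F))"
  proof (rule min_subcover_card_le)
    show "finite (?c ` patterns X (K <#> F))" using finite_patterns KF by simp
    show "X \<subseteq> \<Union>(?c ` patterns X (K <#> F))" by (auto simp: patterns_def)
    fix w assume "w \<in> ?c ` patterns X (K <#> F)"
    then obtain y where y: "y \<in> X" "w = ?c (restrict y (K <#> F))" by (auto simp: patterns_def)
    have "\<forall>g\<in>F. \<exists>U\<in>\<U>. \<forall>x\<in>X. (\<forall>k\<in>K. x k = shift G g y k) \<longrightarrow> x \<in> U"
      using K(1) shift_in_X y(1) F by blast
    then obtain U where U: "\<And>g. g \<in> F \<Longrightarrow> U g \<in> \<U>"
      "\<And>g x. g \<in> F \<Longrightarrow> x \<in> X \<Longrightarrow> \<forall>k\<in>K. x k = shift G g y k \<Longrightarrow> x \<in> U g" by metis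
    have "(\<Inter>g\<in>F. {x \<in> X. shift G g x \<in> U g}) \<in> join_cover G X \<U> F"
      using U(1) by (auto simp: join_cover_def)
    moreover have "w \<inter> X \<subseteq> (\<Inter>g\<in>F. {x \<in> X. shift G g x \<in> U g})"
    proof (intro subsetI INT_I)
      fix x g assume x: "x \<in> w \<inter> X" and g: "g \<in> F"
      then have eq: "\<forall>h\<in>K <#> F. x h = y h" by (simp add: y restrict_eq_iff)
      have "shift G g x \<in> U g"
      proof (rule U(2)[OF g])
        show "shift G g x \<in> X" using shift_in_X x g F by blast
        show "\<forall>k\<in>K. shift G g x k = shift G g y k"
        proof
          fix k assume k: "k \<in> K"
          then have "k \<otimes> g \<in> K <#> F" using g by (auto simp: set_mult_def)
          then show "shift G g x k = shift G g y k" using eq k K(3) by (auto simp: shift_apply)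
        qed
      qed
      then show "x \<in> {x \<in> X. shift G g x \<in> U g}" using x by auto
    qed
    ultimately show "\<exists>v\<in>join_cover G X \<U> F. w \<inter> X \<subseteq> v" by blast
  qed
  also have "\<dots> \<le> card (patterns X (K <#> F))" using finite_patterns KF by (intro card_image_le)
  finally show ?thesis .
qed

end

section \<open>The generating cover\<close>

context finite_subshift
begin

definition generator :: "('a \<Rightarrow> 'b) set set" where
  "generator = (\<lambda>a. {x \<in> X. x \<one> = a}) ` A"

lemma generator_cover: "generator \<in> finite_open_covers (full_shift G A) X"
proof -
  have "openin (subtopology (full_shift G A) X) {x \<in> X. x \<one> = a}" for a
  proof -
    have "openin (full_shift G A) {x \<in> carrier G \<rightarrow>\<^sub>E A. \<forall>g\<in>{\<one>}. x g = (\<lambda>_. a) g}"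
      by (rule openin_cylinder) auto
    moreover have "{x \<in> X. x \<one> = a} = {x \<in> carrier G \<rightarrow>\<^sub>E A. \<forall>g\<in>{\<one>}. x g = (\<lambda>_. a) g} \<inter> X"
      using X_subset by auto
    ultimately show ?thesis unfolding openin_subtopology by blast
  qed
  moreover have "\<Union>generator = X" using X_apply by (auto simp: generator_def)
  ultimately show ?thesis using finite_A by (auto simp: finite_open_covers_def generator_def)
qed

text \<open>The shift of \<open>x\<close> by \<open>g\<close> reads the symbol \<open>x g\<close> at
  the identity. A member of the join therefore determines its points on all of \<open>F\<close> and
  carries at most one pattern.\<close>

lemma card_patterns_le_generator:
  assumes F: "finite F" "F \<subseteq> carrier G"
  shows "card (patterns X F) \<le> min_subcover_card X (join_cover G X generator F)"
proof -
  interpret covered_subshift G A X generator by unfold_locales (rule generator_cover)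
  obtain W where W: "W \<subseteq> join_cover G X generator F" "finite W" "X \<subseteq> \<Union>W" "card W = N F"
    using N_attained[OF F] .
  have det: "restrict x F = restrict y F" if w: "w \<in> W" "x \<in> w \<inter> X" "y \<in> w \<inter> X" for w x y
  proof -
    obtain U where U: "U \<in> F \<rightarrow> generator" "w = (\<Inter>g\<in>F. {x \<in> X. shift G g x \<in> U g})"
      using w(1) W(1) unfolding join_cover_def by blast
    have "x g = y g" if g: "g \<in> F" for g
    proof -
      have "U g \<in> generator" using U g by auto
      then obtain a where "U g = {x \<in> X. x \<one> = a}" by (auto simp: generator_def)
      moreover have "shift G g x \<in> U g" "shift G g y \<in> U g" using U g w(2,3) by auto
      ultimately have "shift G g x \<one> = shift G g y \<one>" by auto
      then show ?thesis using g F by (auto simp: shift_apply subset_iff)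
    qed
    then show ?thesis by (auto simp: restrict_eq_iff)
  qed
  have "patterns X F \<subseteq> (\<lambda>w. restrict (SOME x. x \<in> w \<inter> X) F) ` W"
  proof
    fix p assume "p \<in> patterns X F"
    then obtain x where x: "x \<in> X" "p = restrict x F" by (auto simp: patterns_def)
    then obtain w where w: "w \<in> W" "x \<in> w \<inter> X" using W(3) by blast
    then have "(SOME x. x \<in> w \<inter> X) \<in> w \<inter> X" by (metis someI)
    then have "p = restrict (SOME x. x \<in> w \<inter> X) F" using det[OF w(1)] w(2) x(2) by blast
    then show "p \<in> (\<lambda>w. restrict (SOME x. x \<in> w \<inter> X) F) ` W" using w(1) by blast
  qed
  then have "card (patterns X F) \<le> card W" using W(2) by (meson surj_card_le)
  then show ?thesis using W by simp
qed

end

section \<open>Counting patterns with a weighted cover\<close>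

context finite_subshift
begin

text \<open>A point \<open>x\<close> is encoded by its tiles, each labelled with the cylinder containing the shifted point, and
  by the symbols on the uncovered part. The weights of all sets of labelled tiles sum to a product
  \<open>\<Prod>(1 + w)\<close>, so the positions of the tiles cost almost nothing.\<close>

lemma card_patterns_le_weights:
  fixes F :: "nat \<Rightarrow> 'a set" and Q :: "nat \<Rightarrow> (nat \<times> ('a \<Rightarrow> 'b)) set" and \<eta> \<epsilon> s \<tau> :: real
  assumes F: "\<And>n. F n \<subseteq> carrier G"
    and E: "finite E" "E \<subseteq> carrier G" and "X \<noteq> {}"
    and Q: "\<And>j. j < M \<Longrightarrow> finite (Q j)"
      "\<And>j x. j < M \<Longrightarrow> x \<in> X \<Longrightarrow> \<exists>r\<in>Q j. \<forall>g\<in>F (fst r). x g = snd r g"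
      "\<And>j. j < M \<Longrightarrow> (\<Sum>r\<in>Q j. exp (- s * real (card (F (fst r))))) \<le> \<tau>"
    and s: "s \<ge> 0" and \<epsilon>: "\<epsilon> < 1"
    and tiling: "\<And>\<nu>. (\<forall>j<M. \<forall>c\<in>E. \<nu> j c \<in> fst ` Q j) \<Longrightarrow>
      (\<exists>S. S \<subseteq> {..<M} \<times> E \<and> (\<forall>p\<in>S. F (\<nu> (fst p) (snd p)) #> snd p \<subseteq> E) \<and>
        (1 - \<epsilon>) * (\<Sum>p\<in>S. real (card (F (\<nu> (fst p) (snd p))))) \<le> real (card E) \<and>
        real (card (E - (\<Union>p\<in>S. F (\<nu> (fst p) (snd p)) #> snd p))) \<le> \<eta> * real (card E))"
  shows "real (card (patterns X E)) \<le>
    exp (real (card E) * (\<eta> * ln (real (card A)) + s / (1 - \<epsilon>) + real M * \<tau>))"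
proof -
  let ?a = "real (card A)" and ?e = "real (card E)"
  obtain x0 where "x0 \<in> X" using \<open>X \<noteq> {}\<close> by auto
  then have "x0 \<one> \<in> A" using X_apply by auto
  then have a: "?a \<ge> 1" using finite_A by (metis card_gt_0_iff empty_iff One_nat_def Suc_leI of_nat_1 of_nat_le_iff)
  \<comment> \<open>\<open>q x j c\<close> is the label, a level with a pattern, that layer
    \<open>j\<close> gives to the shift of \<open>x\<close> by \<open>c\<close>. Its level is the
    assignment \<nu> to which the tiling hypothesis is applied.\<close>
  have "\<exists>r. r \<in> Q j \<and> (\<forall>t\<in>F (fst r). shift G c x t = snd r t)" if "x \<in> X" "j < M" "c \<in> E" for x j c
    using Q(2)[OF that(2) shift_in_X[of c x]] that E by blast
  then obtain q where q: "\<And>x j c. x \<in> X \<Longrightarrow> j < M \<Longrightarrow> c \<in> E \<Longrightarrow> q x j c \<in> Q j"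
    "\<And>x j c t. x \<in> X \<Longrightarrow> j < M \<Longrightarrow> c \<in> E \<Longrightarrow> t \<in> F (fst (q x j c)) \<Longrightarrow> shift G c x t = snd (q x j c) t"
    by metis
  define ok where "ok x S \<longleftrightarrow> S \<subseteq> {..<M} \<times> E \<and>
        (1 - \<epsilon>) * (\<Sum>p\<in>S. real (card (F (fst (q x (fst p) (snd p)))))) \<le> ?e \<and>
        real (card (E - (\<Union>p\<in>S. F (fst (q x (fst p) (snd p))) #> snd p))) \<le> \<eta> * ?e" for x S
  have "\<exists>S. ok x S" if "x \<in> X" for x
    unfolding ok_def using tiling[of "\<lambda>j c. fst (q x j c)"] q(1)[OF that] by blast
  then obtain S where "\<And>x. x \<in> X \<Longrightarrow> ok x (S x)" by metis
  then have S: "\<And>x. x \<in> X \<Longrightarrow> S x \<subseteq> {..<M} \<times> E"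
    "\<And>x. x \<in> X \<Longrightarrow> (1 - \<epsilon>) * (\<Sum>p\<in>S x. real (card (F (fst (q x (fst p) (snd p)))))) \<le> ?e"
    "\<And>x. x \<in> X \<Longrightarrow> real (card (E - (\<Union>p\<in>S x. F (fst (q x (fst p) (snd p))) #> snd p))) \<le> \<eta> * ?e"
    by (auto simp: ok_def)
  define R where "R = (SIGMA p:{..<M} \<times> E. Q (fst p))"
  define Z where "Z x = (\<lambda>p. (p, q x (fst p) (snd p))) ` S x" for x
  define L where "L Y = E - (\<Union>y\<in>Y. F (fst (snd y)) #> snd (fst y))" for Y :: "((nat \<times> 'a) \<times> (nat \<times> ('a \<Rightarrow> 'b))) set"
  define w where "w y = exp (- s * real (card (F (fst (snd y)))))" for y :: "(nat \<times> 'a) \<times> (nat \<times> ('a \<Rightarrow> 'b))"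
  have finR: "finite R" unfolding R_def using E Q(1) by (intro finite_SigmaI) auto
  have ZR: "Z x \<subseteq> R" if "x \<in> X" for x
    using S(1)[OF that] q(1)[OF that] by (fastforce simp: Z_def R_def)
  have LZ: "L (Z x) = E - (\<Union>p\<in>S x. F (fst (q x (fst p) (snd p))) #> snd p)" for x
    by (simp add: L_def Z_def)
  have finL: "finite (L Y)" for Y using E by (simp add: L_def)
  have det: "restrict x E = restrict y E"
    if xy: "x \<in> X" "y \<in> X" "Z x = Z y" "restrict x (L (Z x)) = restrict y (L (Z x))" for x y
    unfolding restrict_eq_iff
  proof
    fix g assume g: "g \<in> E"
    show "x g = y g"
    proof (cases "g \<in> L (Z x)")
      case True
      then show ?thesis using xy(4) by (simp add: restrict_eq_iff)
    next
      case False
      then obtain p r where pr: "(p, r) \<in> Z x" "g \<in> F (fst r) #> snd p"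
        using g by (auto simp: L_def)
      obtain t where t: "t \<in> F (fst r)" "g = t \<otimes> snd p" using pr(2) by (auto simp: r_coset_def)
      \<comment> \<open>The symbols on a tile can be read from its label, so all points whose code
        contains \<open>(p, r)\<close> coincide there.\<close>
      have "z g = snd r t" if z: "z \<in> X" "(p, r) \<in> Z z" for z
      proof -
        have r: "r = q z (fst p) (snd p)" and p: "p \<in> S z" using z(2) by (auto simp: Z_def)
        have pE: "fst p < M" "snd p \<in> E" using S(1)[OF z(1)] p by auto
        have "z g = shift G (snd p) z t" using t F by (auto simp: shift_apply subset_iff)
        also have "\<dots> = snd r t" using q(2)[OF z(1) pE] t(1) r by simp
        finally show ?thesis .
      qed
      then show ?thesis using xy pr(1) by metis
    qed
  qed
  define B where "B = (SIGMA Y:Z ` X. L Y \<rightarrow>\<^sub>E A)"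
  have finZ: "finite (Z ` X)" using ZR finR by (intro finite_subset[of "Z ` X" "Pow R"]) auto
  have finB: "finite B" unfolding B_def using finZ finL finite_A by (intro finite_SigmaI finite_PiE) auto
  \<comment> \<open>Decoding picks any point with the given code; by \<open>det\<close> its
    restriction to \<open>E\<close> does not depend on the pick.\<close>
  let ?dec = "\<lambda>b. restrict (SOME x. x \<in> X \<and> Z x = fst b \<and> restrict x (L (fst b)) = snd b) E"
  have "patterns X E \<subseteq> ?dec ` B"
  proof
    fix p assume "p \<in> patterns X E"
    then obtain x where x: "x \<in> X" "p = restrict x E" by (auto simp: patterns_def)
    define y where "y = (SOME y. y \<in> X \<and> Z y = Z x \<and> restrict y (L (Z x)) = restrict x (L (Z x)))"
    have "y \<in> X \<and> Z y = Z x \<and> restrict y (L (Z x)) = restrict x (L (Z x))"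
      unfolding y_def by (rule someI[of _ x]) (use x in auto)
    then have "p = restrict y E" using det[of y x] x by simp
    then have "p = ?dec (Z x, restrict x (L (Z x)))" by (simp add: y_def)
    moreover have "restrict x (L (Z x)) \<in> L (Z x) \<rightarrow>\<^sub>E A"
      using X_apply[OF x(1)] E by (auto simp: L_def)
    then have "(Z x, restrict x (L (Z x))) \<in> B" using x by (auto simp: B_def)
    ultimately show "p \<in> ?dec ` B" by blast
  qed
  then have "card (patterns X E) \<le> card B" using finB by (meson surj_card_le)
  also have "card B = (\<Sum>Y\<in>Z ` X. card A ^ card (L Y))"
    unfolding B_def using finZ finL finite_A by (subst card_SigmaI) (auto simp: card_PiE intro: finite_PiE)
  finally have "real (card (patterns X E)) \<le> (\<Sum>Y\<in>Z ` X. ?a ^ card (L Y))"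
    unfolding of_nat_power[symmetric] of_nat_sum[symmetric] of_nat_le_iff .
  also have "\<dots> \<le> (\<Sum>Y\<in>Z ` X. exp (?e * (\<eta> * ln ?a + s / (1 - \<epsilon>))) * (\<Prod>y\<in>Y. w y))"
  proof (rule sum_mono)
    fix Y assume "Y \<in> Z ` X"
    then obtain x where x: "x \<in> X" "Y = Z x" by auto
    have "?a ^ card (L Y) = exp (real (card (L Y)) * ln ?a)"
      using a by (simp add: exp_of_nat_mult)
    also have "\<dots> \<le> exp (\<eta> * ?e * ln ?a)"
      using S(3)[OF x(1)] a by (simp add: x LZ mult_right_mono)
    finally have 1: "?a ^ card (L Y) \<le> exp (?e * (\<eta> * ln ?a))" by (simp add: mult_ac)
    have finS: "finite (S x)" using S(1)[OF x(1)] E(1) by (meson finite_SigmaI finite_lessThan finite_subset)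
    have "(\<Prod>y\<in>Y. w y) = (\<Prod>p\<in>S x. exp (- s * real (card (F (fst (q x (fst p) (snd p)))))))"
      unfolding x Z_def by (subst prod.reindex) (auto simp: inj_on_def w_def)
    also have "\<dots> = exp (- s * (\<Sum>p\<in>S x. real (card (F (fst (q x (fst p) (snd p)))))))"
      using finS by (simp add: exp_sum[symmetric] sum_distrib_left)
    finally have prod_w: "(\<Prod>y\<in>Y. w y) = exp (- s * (\<Sum>p\<in>S x. real (card (F (fst (q x (fst p) (snd p)))))))" .
    have "(\<Sum>p\<in>S x. real (card (F (fst (q x (fst p) (snd p)))))) \<le> ?e / (1 - \<epsilon>)"
      using S(2)[OF x(1)] \<epsilon> by (simp add: pos_le_divide_eq mult.commute)
    from mult_left_mono[OF this s] have 2: "exp (- s * (?e / (1 - \<epsilon>))) \<le> (\<Prod>y\<in>Y. w y)"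
      unfolding prod_w by simp
    \<comment> \<open>The two inserted exponentials cancel. The second is at most the weight of the
      family \<open>Y\<close>, whose tiles have total size at most
      \<open>?e / (1 - \<epsilon>)\<close>.\<close>
    have "?a ^ card (L Y) \<le> exp (?e * (\<eta> * ln ?a)) * (exp (?e * (s / (1 - \<epsilon>))) * exp (- s * (?e / (1 - \<epsilon>))))"
      using 1 by (simp add: exp_add[symmetric] mult.commute)
    also have "\<dots> \<le> exp (?e * (\<eta> * ln ?a)) * (exp (?e * (s / (1 - \<epsilon>))) * (\<Prod>y\<in>Y. w y))"
      using 2 by (intro mult_left_mono) auto
    also have "\<dots> = exp (?e * (\<eta> * ln ?a + s / (1 - \<epsilon>))) * (\<Prod>y\<in>Y. w y)"
      by (simp add: exp_add distrib_left)
    finally show "?a ^ card (L Y) \<le> exp (?e * (\<eta> * ln ?a + s / (1 - \<epsilon>))) * (\<Prod>y\<in>Y. w y)" .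
  qed
  also have "\<dots> = exp (?e * (\<eta> * ln ?a + s / (1 - \<epsilon>))) * (\<Sum>Y\<in>Z ` X. \<Prod>y\<in>Y. w y)"
    by (simp add: sum_distrib_left)
  also have "\<dots> \<le> exp (?e * (\<eta> * ln ?a + s / (1 - \<epsilon>))) * exp (?e * (real M * \<tau>))"
  proof (intro mult_left_mono)
    have "(\<Sum>Y\<in>Z ` X. \<Prod>y\<in>Y. w y) \<le> (\<Sum>Y\<in>Pow R. \<Prod>y\<in>Y. w y)"
      using ZR finR by (intro sum_mono2) (auto intro!: prod_nonneg simp: w_def)
    also have "\<dots> = (\<Prod>y\<in>R. w y + 1)"
      using prod_add[OF finR, of w "\<lambda>_. 1"] by simp
    also have "\<dots> \<le> (\<Prod>y\<in>R. exp (w y))"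
      by (intro prod_mono) (auto simp: w_def add.commute[of _ 1] add_nonneg_nonneg)
    also have "\<dots> = exp (\<Sum>y\<in>R. w y)" using finR by (simp add: exp_sum)
    also have "(\<Sum>y\<in>R. w y) = (\<Sum>p\<in>{..<M} \<times> E. \<Sum>r\<in>Q (fst p). w (p, r))"
      unfolding R_def using E Q(1) by (subst sum.Sigma) auto
    \<comment> \<open>At each of the \<open>M * card E\<close> positions, all labels together weigh
      at most \<tau>.\<close>
    also have "\<dots> \<le> (\<Sum>p\<in>{..<M} \<times> E. \<tau>)"
      using Q(3) by (intro sum_mono) (auto simp: w_def)
    also have "\<dots> = ?e * (real M * \<tau>)" by (simp add: card_cartesian_product)
    finally show "(\<Sum>Y\<in>Z ` X. \<Prod>y\<in>Y. w y) \<le> exp (?e * (real M * \<tau>))" by simp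
  qed auto
  also have "\<dots> = exp (?e * (\<eta> * ln ?a + s / (1 - \<epsilon>) + real M * \<tau>))"
    by (simp add: exp_add[symmetric] algebra_simps)
  finally show ?thesis .
qed

end

section \<open>The metric and the Hausdorff measure\<close>

locale folner_shift = finite_subshift G A X for G (structure) and A :: "'b set" and X +
  fixes F :: "nat \<Rightarrow> 'a set"
  assumes folner: "folner_sequence G F"
    and F_Suc: "\<And>n. F n \<subseteq> F (Suc n)"
    and F_exhaust: "(\<Union>n. F n) = carrier G"
    and infinite_carrier: "infinite (carrier G)"
begin

abbreviation \<Omega> where "\<Omega> \<equiv> carrier G \<rightarrow>\<^sub>E A"
abbreviation d where "d \<equiv> shift_dist F"
abbreviation cardF where "cardF n \<equiv> real (card (F n))"

lemma F: "finite (F n)" "F n \<noteq> {}" "F n \<subseteq> carrier G"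
  using folner by (auto simp: folner_sequence_def)

lemma F_mono: "m \<le> n \<Longrightarrow> F m \<subseteq> F n"
  by (rule lift_Suc_mono_le[of F, OF F_Suc])

lemma cardF_mono: "m \<le> n \<Longrightarrow> cardF m \<le> cardF n"
  using F_mono F by (simp add: card_mono)

lemma cardF_at_top: "filterlim cardF at_top sequentially"
proof -
  have "\<exists>n. real k \<le> cardF n" for k
  proof -
    obtain B where B: "finite B" "card B = k" "B \<subseteq> carrier G"
      using infinite_arbitrarily_large[OF infinite_carrier] by blast
    have "\<forall>b\<in>B. \<exists>n. b \<in> F n" using B F_exhaust by blast
    then obtain i where i: "\<And>b. b \<in> B \<Longrightarrow> b \<in> F (i b)" by metis
    obtain m where m: "\<And>b. b \<in> B \<Longrightarrow> i b \<le> m"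
      using B(1) by (metis finite_imageI finite_nat_set_iff_bounded_le imageI)
    have "B \<subseteq> F m" using i m F_mono by blast
    then show ?thesis using B F by (auto intro!: exI[of _ m] card_mono)
  qed
  then show ?thesis
    unfolding filterlim_at_top eventually_sequentially
    by (meson cardF_mono order_trans real_arch_simple)
qed

text \<open>\<open>GREATEST\<close> is meaningful only if the levels of agreement are bounded. As
  the sets \<open>F n\<close> are nested, one disagreement inside \<open>F b\<close> provides the
  bound.\<close>

lemma greatest_agreement:
  assumes "\<forall>g\<in>F n. x g = y g" "g \<in> F b" "x g \<noteq> y g"
  defines "m \<equiv> GREATEST n. \<forall>g\<in>F n. x g = y g"
  shows "\<forall>g\<in>F m. x g = y g" "n \<le> m" "m < b"
proof -
  have bound: "k \<le> b" if "\<forall>g\<in>F k. x g = y g" for k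
    using that assms(2,3) F_mono[of b k] by (meson nat_le_linear subsetD)
  let ?P = "\<lambda>n. \<forall>g\<in>F n. x g = y g"
  show agree: "\<forall>g\<in>F m. x g = y g"
    unfolding m_def using GreatestI_nat[of ?P n b] assms(1) bound by blast
  show "n \<le> m"
    unfolding m_def using Greatest_le_nat[of ?P n b] assms(1) bound by blast
  have "m \<le> b" using bound agree .
  moreover have "m \<noteq> b" using agree assms(2,3) by auto
  ultimately show "m < b" by simp
qed

lemma d_le:
  assumes "x \<in> \<Omega>" "y \<in> \<Omega>" "\<forall>g\<in>F n. x g = y g"
  shows "d x y \<le> exp (- cardF n)"
proof (cases "x = y")
  case False
  then obtain g where "g \<in> carrier G" "x g \<noteq> y g" using assms PiE_ext by metis
  then obtain b where b: "g \<in> F b" using F_exhaust by blast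
  have "n \<le> (GREATEST n. \<forall>g\<in>F n. x g = y g)"
    using greatest_agreement(2)[OF assms(3) b \<open>x g \<noteq> y g\<close>] .
  moreover have "\<not> (\<exists>g\<in>F 0. x g \<noteq> y g)" using assms(3) F_mono[of 0 n] by auto
  ultimately show ?thesis using False cardF_mono by (simp add: shift_dist_def)
qed (simp add: shift_dist_def)

text \<open>A disagreement in \<open>F (Suc n)\<close> leaves \<open>n\<close> as the last level on
  which the points can agree, whence the shift of index; a disagreement already in
  \<open>F 0\<close> gives distance 1.\<close>

lemma d_ge:
  assumes "g \<in> F (Suc n)" "x g \<noteq> y g"
  shows "exp (- cardF n) \<le> d x y"
proof (cases "\<exists>g\<in>F 0. x g \<noteq> y g")
  case True
  then show ?thesis by (auto simp: shift_dist_def)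
next
  case False
  then have "\<forall>g\<in>F 0. x g = y g" by auto
  from greatest_agreement(3)[OF this assms]
  have "(GREATEST n. \<forall>g\<in>F n. x g = y g) \<le> n" by simp
  then show ?thesis using False assms(2) cardF_mono by (auto simp: shift_dist_def)
qed

lemma d_bounds: "0 \<le> d x y" "d x y \<le> 1"
  by (auto simp: shift_dist_def)

lemma d_le_diam: "x \<in> E \<Longrightarrow> y \<in> E \<Longrightarrow> d x y \<le> diam d E"
proof -
  assume xy: "x \<in> E" "y \<in> E"
  have "(\<lambda>(x, y). d x y) (x, y) \<le> (SUP (x, y)\<in>E \<times> E. d x y)"
    by (rule cSUP_upper) (use xy d_bounds in \<open>auto intro!: bdd_aboveI[of _ 1]\<close>)
  then show ?thesis using xy by (auto simp: diam_def)
qed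

lemma diam_le:
  assumes "E \<noteq> {}" "\<And>x y. x \<in> E \<Longrightarrow> y \<in> E \<Longrightarrow> d x y \<le> c"
  shows "diam d E \<le> c"
proof -
  have "(SUP (x, y)\<in>E \<times> E. d x y) \<le> c" by (rule cSUP_least) (use assms in auto)
  then show ?thesis using assms(1) by (simp add: diam_def)
qed

lemma agree_of_small_diam:
  assumes "diam d E < exp (- cardF n)" "x \<in> E" "y \<in> E" "g \<in> F n"
  shows "x g = y g"
proof (rule ccontr)
  assume "x g \<noteq> y g"
  then have "exp (- cardF n) \<le> d x y" using d_ge assms(4) F_Suc by blast
  then show False using d_le_diam[OF assms(2,3)] assms(1) by simp
qed

text \<open>If \<open>E\<close> has positive diameter, \<open>n\<close> is maximal such that the points of \<open>E\<close> agree on \<open>F n\<close>.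
  The error \<open>\<tau>\<close> is needed only for singletons.\<close>

lemma cylinder_of_small_set:
  assumes E: "E \<noteq> {}" and small: "diam d E < exp (- cardF N)" and s: "s \<ge> 0" and \<tau>: "\<tau> > 0"
  shows "\<exists>n\<ge>N. (\<forall>x\<in>E. \<forall>y\<in>E. \<forall>g\<in>F n. x g = y g) \<and> exp (- s * cardF n) \<le> diam_pow d s E + \<tau>"
proof -
  define agree where "agree n \<longleftrightarrow> (\<forall>x\<in>E. \<forall>y\<in>E. \<forall>g\<in>F n. x g = y g)" for n
  have N: "agree N" using agree_of_small_diam[OF small] by (auto simp: agree_def)
  consider "s = 0" | "s > 0" "\<exists>n. \<not> agree n" | "s > 0" "\<forall>n. agree n" using s by (metis less_eq_real_def)
  then have "\<exists>n\<ge>N. agree n \<and> exp (- s * cardF n) \<le> diam_pow d s E + \<tau>"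
  proof cases
    case 1
    \<comment> \<open>For \<open>s = 0\<close> the weight and \<open>diam_pow d s E\<close> are both
      1, as \<open>E\<close> is nonempty.\<close>
    then show ?thesis using N E \<tau> by (intro exI[of _ N]) (auto simp: diam_pow_def)
  next
    case 2
    \<comment> \<open>The predecessor \<open>k\<close> of the first level of disagreement is the
      level sought: two points differ on \<open>F (Suc k)\<close>, so the diameter is at least
      \<open>exp (- cardF k)\<close>.\<close>
    define n where "n = (LEAST n. \<not> agree n)"
    have n: "\<not> agree n" unfolding n_def using 2(2) by (rule LeastI_ex)
    have agree_below: "agree k" if "k < n" for k using not_less_Least that unfolding n_def by blast
    have "N < n"
    proof (rule ccontr)
      assume "\<not> N < n"
      then have "F n \<subseteq> F N" by (intro F_mono) simp
      then show False using n N by (auto simp: agree_def)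
    qed
    then obtain k where k: "n = Suc k" "N \<le> k" by (cases n) auto
    obtain x y g where xyg: "x \<in> E" "y \<in> E" "g \<in> F (Suc k)" "x g \<noteq> y g"
      using n by (auto simp: agree_def k)
    have le: "exp (- cardF k) \<le> diam d E"
      using d_ge[of g k x y] d_le_diam[of x E y] xyg by linarith
    have "exp (- s * cardF k) = exp (- cardF k) powr s" by (simp add: powr_def mult.commute)
    also have "\<dots> \<le> diam d E powr s" using le s by (intro powr_mono2) auto
    finally have "exp (- s * cardF k) \<le> diam_pow d s E + \<tau>" using E 2(1) \<tau> by (simp add: diam_pow_def)
    then show ?thesis using k agree_below by blast
  next
    case 3
    have "filterlim (\<lambda>n. s * cardF n) at_top sequentially"
      by (rule filterlim_tendsto_pos_mult_at_top[OF tendsto_const 3(1) cardF_at_top])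
    then have "eventually (\<lambda>n. - ln \<tau> \<le> s * cardF n) sequentially" by (simp add: filterlim_at_top)
    then obtain n where n: "n \<ge> N" "- ln \<tau> \<le> s * cardF n"
      unfolding eventually_sequentially by (metis nat_le_linear)
    then have "exp (- s * cardF n) \<le> exp (ln \<tau>)" by simp
    then have "exp (- s * cardF n) \<le> \<tau>" using \<tau> by simp
    moreover have "0 \<le> diam_pow d s E" by (auto simp: diam_pow_def)
    ultimately show ?thesis using n 3(2) by (intro exI[of _ n]) auto
  qed
  then show ?thesis by (auto simp: agree_def)
qed

end

text \<open>A smaller \<epsilon> leaves fewer coverings, so the infimum grows and its one-sided
  limit is a supremum. Hence measure zero means that at every scale there are coverings with
  arbitrarily small sums.\<close>

lemma hausdorff_measure_eq_SUP:
  "hausdorff_measure T d s X =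
    (SUP \<epsilon>\<in>{0<..}. INF \<E>\<in>open_coverings T d X \<epsilon>. \<Sum>\<^sub>\<infinity>E\<in>\<E>. ennreal (diam_pow d s E))"
proof -
  let ?m = "\<lambda>\<epsilon>. INF \<E>\<in>open_coverings T d X \<epsilon>. \<Sum>\<^sub>\<infinity>E\<in>\<E>. ennreal (diam_pow d s E)"
  have anti: "?m \<epsilon>' \<le> ?m \<epsilon>" if "\<epsilon> \<le> \<epsilon>'" for \<epsilon> \<epsilon>'
    using that by (intro INF_superset_mono) (auto simp: open_coverings_def intro: order_trans)
  have "(?m \<longlongrightarrow> (SUP \<epsilon>\<in>{0<..}. ?m \<epsilon>)) (at_right 0)"
  proof (rule order_tendstoI)
    fix a assume "a < (SUP \<epsilon>\<in>{0<..}. ?m \<epsilon>)"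
    then obtain \<epsilon>0 where \<epsilon>0: "\<epsilon>0 > 0" "a < ?m \<epsilon>0" by (auto simp: less_SUP_iff)
    have "eventually (\<lambda>\<epsilon>. \<epsilon> < \<epsilon>0) (at_right (0::real))"
      using \<epsilon>0(1) by (auto simp: eventually_at_right)
    then show "eventually (\<lambda>\<epsilon>. a < ?m \<epsilon>) (at_right 0)"
      by (rule eventually_mono) (rule less_le_trans[OF \<epsilon>0(2) anti[OF less_imp_le]])
  next
    fix a assume a: "(SUP \<epsilon>\<in>{0<..}. ?m \<epsilon>) < a"
    have "eventually (\<lambda>\<epsilon>. \<epsilon> > 0) (at_right (0::real))" by (rule eventually_at_right_less)
    then show "eventually (\<lambda>\<epsilon>. ?m \<epsilon> < a) (at_right 0)"
    proof eventually_elim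
      case (elim \<epsilon>)
      have "?m \<epsilon> \<le> (SUP \<epsilon>\<in>{0<..}. ?m \<epsilon>)" using elim by (intro SUP_upper) auto
      then show ?case using a by (rule le_less_trans)
    qed
  qed
  then show ?thesis unfolding hausdorff_measure_def by (intro tendsto_Lim) auto
qed

lemma infsum_ennreal_finite_subset_le:
  fixes f :: "'x \<Rightarrow> ennreal"
  assumes "B \<subseteq> S" "finite B"
  shows "sum f B \<le> infsum f S"
proof -
  have "infsum f B \<le> infsum f S"
    using assms by (intro infsum_mono_neutral nonneg_summable_on_complete) auto
  then show ?thesis using assms(2) by simp
qed

context folner_shift
begin

text \<open>Compactness reduces a cover with small sum to a finite one. Each member \<open>E\<close>
  is then replaced by a label \<open>(n, y)\<close> with \<open>y\<close> in \<open>E\<close>: the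
  points of \<open>E\<close> agree with \<open>y\<close> on \<open>F n\<close>, and the weight of
  the label exceeds that of \<open>E\<close> by at most \<theta>.\<close>

lemma finite_cylinder_cover:
  assumes null: "hausdorff_measure (full_shift G A) d s X = 0" and s: "s \<ge> 0" and \<tau>: "\<tau> > 0"
  obtains Q :: "(nat \<times> ('a \<Rightarrow> 'b)) set" where "finite Q" "\<And>r. r \<in> Q \<Longrightarrow> N \<le> fst r"
    "\<And>x. x \<in> X \<Longrightarrow> \<exists>r\<in>Q. \<forall>g\<in>F (fst r). x g = snd r g"
    "(\<Sum>r\<in>Q. exp (- s * cardF (fst r))) \<le> \<tau>"
proof -
  define \<delta> where "\<delta> = exp (- cardF N) / 2"
  have \<delta>: "0 < \<delta>" "\<delta> < exp (- cardF N)" by (auto simp: \<delta>_def)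
  let ?m = "\<lambda>\<epsilon>. INF \<E>\<in>open_coverings (full_shift G A) d X \<epsilon>. \<Sum>\<^sub>\<infinity>E\<in>\<E>. ennreal (diam_pow d s E)"
  have "?m \<delta> \<le> (SUP \<epsilon>\<in>{0<..}. ?m \<epsilon>)" using \<delta> by (intro SUP_upper) auto
  also have "\<dots> = 0" using null by (simp add: hausdorff_measure_eq_SUP)
  finally have "?m \<delta> < ennreal (\<tau> / 2)" using \<tau> by (simp add: le_zero_eq)
  then obtain \<E> where \<E>: "\<E> \<in> open_coverings (full_shift G A) d X \<delta>"
    "(\<Sum>\<^sub>\<infinity>E\<in>\<E>. ennreal (diam_pow d s E)) < ennreal (\<tau> / 2)"
    unfolding INF_less_iff by blast
  then have op: "\<And>E. E \<in> \<E> \<Longrightarrow> openin (full_shift G A) E" "\<And>E. E \<in> \<E> \<Longrightarrow> diam d E \<le> \<delta>" "X \<subseteq> \<Union>\<E>"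
    by (auto simp: open_coverings_def)
  then obtain \<F>' where \<F>': "finite \<F>'" "\<F>' \<subseteq> \<E>" "X \<subseteq> \<Union>\<F>'"
    using compactin_X unfolding compactin_def by meson
  \<comment> \<open>Empty members are discarded because a label needs a point of the set.\<close>
  define \<F> where "\<F> = \<F>' - {{}}"
  have \<F>: "finite \<F>" "\<F> \<subseteq> \<E>" "X \<subseteq> \<Union>\<F>" "{} \<notin> \<F>" using \<F>' by (auto simp: \<F>_def)
  \<comment> \<open>The errors of all members then add up to at most
    \<open>\<tau> / 2\<close>.\<close>
  define \<theta> where "\<theta> = \<tau> / (2 * (real (card \<F>) + 1))"
  have \<theta>: "\<theta> > 0" using \<tau> by (simp add: \<theta>_def)
  have "\<exists>n\<ge>N. (\<forall>x\<in>E. \<forall>y\<in>E. \<forall>g\<in>F n. x g = y g) \<and> exp (- s * cardF n) \<le> diam_pow d s E + \<theta>" if "E \<in> \<F>" for E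
  proof (rule cylinder_of_small_set[OF _ _ s \<theta>])
    show "E \<noteq> {}" using that \<F> by auto
    show "diam d E < exp (- cardF N)" using op(2)[of E] that \<F>(2) \<delta> by auto
  qed
  then obtain n where n: "\<And>E. E \<in> \<F> \<Longrightarrow> N \<le> n E"
    "\<And>E x y g. E \<in> \<F> \<Longrightarrow> x \<in> E \<Longrightarrow> y \<in> E \<Longrightarrow> g \<in> F (n E) \<Longrightarrow> x g = y g"
    "\<And>E. E \<in> \<F> \<Longrightarrow> exp (- s * cardF (n E)) \<le> diam_pow d s E + \<theta>" by metis
  define y where "y E = (SOME x. x \<in> E)" for E :: "('a \<Rightarrow> 'b) set"
  have y: "y E \<in> E" if "E \<in> \<F>" for E using that \<F>(4) unfolding y_def by (metis some_in_eq)
  have nonneg: "0 \<le> diam_pow d s E" for E by (auto simp: diam_pow_def)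
  have "ennreal (\<Sum>E\<in>\<F>. diam_pow d s E) \<le> (\<Sum>\<^sub>\<infinity>E\<in>\<E>. ennreal (diam_pow d s E))"
    using infsum_ennreal_finite_subset_le[OF \<F>(2,1), of "\<lambda>E. ennreal (diam_pow d s E)"]
    by (subst (asm) sum_ennreal) (simp_all add: nonneg)
  also note \<E>(2)
  finally have sum: "(\<Sum>E\<in>\<F>. diam_pow d s E) < \<tau> / 2"
    using \<tau> by (subst (asm) ennreal_less_iff) (auto intro: sum_nonneg nonneg)
  show thesis
  proof (rule that[of "(\<lambda>E. (n E, y E)) ` \<F>"])
    show "\<exists>r\<in>(\<lambda>E. (n E, y E)) ` \<F>. \<forall>g\<in>F (fst r). x g = snd r g" if x: "x \<in> X" for x
    proof -
      obtain E where E: "E \<in> \<F>" "x \<in> E" using x \<F>(3) by blast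
      then have "\<forall>g\<in>F (n E). x g = y E g" using n(2)[OF E y[OF E(1)]] by blast
      then show ?thesis using E(1) by force
    qed
    have "(\<Sum>r\<in>(\<lambda>E. (n E, y E)) ` \<F>. exp (- s * cardF (fst r))) \<le> (\<Sum>E\<in>\<F>. exp (- s * cardF (n E)))"
      by (rule order_trans[OF sum_image_le]) (use \<F>(1) in auto)
    also have "\<dots> \<le> (\<Sum>E\<in>\<F>. diam_pow d s E + \<theta>)" by (rule sum_mono) (rule n(3))
    also have "\<dots> = (\<Sum>E\<in>\<F>. diam_pow d s E) + real (card \<F>) * \<theta>" by (simp add: sum.distrib)
    also have "real (card \<F>) * \<theta> \<le> \<tau> / 2" using \<tau> by (simp add: \<theta>_def field_simps)
    finally show "(\<Sum>r\<in>(\<lambda>E. (n E, y E)) ` \<F>. exp (- s * cardF (fst r))) \<le> \<tau>" using sum by simp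
  qed (use \<F>(1) n(1) in auto)
qed

text \<open>At most \<open>exp (h * cardF n)\<close> cylinders over \<open>F n\<close>, each of
  diameter at most \<open>exp (- cardF n)\<close>, cover \<open>X\<close>. Their sum is at most
  \<open>exp (- (s - h) * cardF n)\<close>, which tends to 0.\<close>

lemma hausdorff_measure_null:
  assumes s: "s > 0" and hs: "h < s"
    and h: "eventually (\<lambda>n. real (card (patterns X (F n))) \<le> exp (h * cardF n)) sequentially"
  shows "hausdorff_measure (full_shift G A) d s X = 0"
proof -
  let ?m = "\<lambda>\<epsilon>. INF \<E>\<in>open_coverings (full_shift G A) d X \<epsilon>. \<Sum>\<^sub>\<infinity>E\<in>\<E>. ennreal (diam_pow d s E)"
  have "?m \<epsilon> \<le> 0" if \<epsilon>: "\<epsilon> > 0" for \<epsilon>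
  proof (rule ennreal_le_epsilon)
    fix \<theta> :: real assume \<theta>: "\<theta> > 0"
    have "filterlim (\<lambda>n. (s - h) * cardF n) at_top sequentially"
      by (rule filterlim_tendsto_pos_mult_at_top[OF tendsto_const _ cardF_at_top]) (use hs in simp)
    then have "eventually (\<lambda>n. - ln \<theta> \<le> (s - h) * cardF n) sequentially" by (simp add: filterlim_at_top)
    moreover have "eventually (\<lambda>n. - ln \<epsilon> \<le> cardF n) sequentially"
      using cardF_at_top by (simp add: filterlim_at_top)
    ultimately have "eventually (\<lambda>n. - ln \<theta> \<le> (s - h) * cardF n \<and> - ln \<epsilon> \<le> cardF n \<and>
        real (card (patterns X (F n))) \<le> exp (h * cardF n)) sequentially"
      using h by eventually_elim simp
    then obtain n where n: "- ln \<theta> \<le> (s - h) * cardF n" "- ln \<epsilon> \<le> cardF n"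
      "real (card (patterns X (F n))) \<le> exp (h * cardF n)"
      using eventually_happens' sequentially_bot by blast
    define cyl where "cyl p = {x \<in> \<Omega>. \<forall>g\<in>F n. x g = p g}" for p
    let ?\<E> = "cyl ` patterns X (F n)"
    have finP: "finite (patterns X (F n))" using finite_patterns F by auto
    have diam_cyl: "diam d (cyl p) \<le> exp (- cardF n)" for p
    proof (cases "cyl p = {}")
      case False
      then show ?thesis by (intro diam_le d_le) (auto simp: cyl_def)
    qed (simp add: diam_def)
    have "exp (- cardF n) \<le> exp (ln \<epsilon>)" using n(2) by simp
    then have "exp (- cardF n) \<le> \<epsilon>" using \<epsilon> by simp
    then have "diam d (cyl p) \<le> \<epsilon>" for p using diam_cyl order_trans by blast
    moreover have "openin (full_shift G A) (cyl p)" for p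
      unfolding cyl_def using F by (intro openin_cylinder) auto
    moreover have "X \<subseteq> \<Union>?\<E>" using X_subset by (auto simp: cyl_def patterns_def)
    ultimately have "?\<E> \<in> open_coverings (full_shift G A) d X \<epsilon>"
      using finP by (auto simp: open_coverings_def intro: countable_finite)
    then have "?m \<epsilon> \<le> (\<Sum>\<^sub>\<infinity>E\<in>?\<E>. ennreal (diam_pow d s E))" by (rule INF_lower)
    also have "\<dots> = (\<Sum>E\<in>?\<E>. ennreal (diam_pow d s E))" using finP by simp
    also have "\<dots> \<le> (\<Sum>E\<in>?\<E>. ennreal (exp (- s * cardF n)))"
    proof (intro sum_mono ennreal_leI)
      fix E assume "E \<in> ?\<E>"
      then obtain p where p: "E = cyl p" by auto
      show "diam_pow d s E \<le> exp (- s * cardF n)"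
      proof (cases "E = {}")
        case False
        then obtain x where "x \<in> E" by auto
        then have "0 \<le> diam d E" using d_le_diam[of x E x] d_bounds(1)[of x x] by linarith
        then have "diam d E powr s \<le> exp (- cardF n) powr s"
          using diam_cyl[of p] s p by (intro powr_mono2) auto
        also have "\<dots> = exp (- s * cardF n)" by (simp add: powr_def mult.commute)
        finally show ?thesis using False s by (simp add: diam_pow_def)
      qed (simp add: diam_pow_def)
    qed
    also have "\<dots> = ennreal (real (card ?\<E>) * exp (- s * cardF n))"
      by (simp add: ennreal_mult ennreal_of_nat_eq_real_of_nat)
    also have "\<dots> \<le> ennreal \<theta>"
    proof (rule ennreal_leI)
      have "real (card ?\<E>) \<le> exp (h * cardF n)"
        using card_image_le[OF finP, of cyl] n(3) by linarith
      then have "real (card ?\<E>) * exp (- s * cardF n) \<le> exp (h * cardF n) * exp (- s * cardF n)"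
        by (intro mult_right_mono) auto
      also have "\<dots> = exp (- ((s - h) * cardF n))" by (simp add: exp_add[symmetric] algebra_simps)
      also have "\<dots> \<le> exp (ln \<theta>)" using n(1) by simp
      also have "\<dots> = \<theta>" using \<theta> by simp
      finally show "real (card ?\<E>) * exp (- s * cardF n) \<le> \<theta>" .
    qed
    finally show "?m \<epsilon> \<le> 0 + ennreal \<theta>" by simp
  qed
  then show ?thesis unfolding hausdorff_measure_eq_SUP by (simp add: SUP_eq_iff)
qed

end

section \<open>Comparison of dimension and entropy\<close>

context folner_shift
begin

text \<open>The excess \<xi> is shared in thirds: by the overlaps, which raise \<open>s\<close> to
  \<open>s / (1 - \<epsilon>)\<close>, by the free symbols on the uncovered part, and by the choice
  of labelled tiles in the \<open>M\<close> layers. The constants depend on each other in this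
  order: \<epsilon> and \<eta> determine \<open>M\<close>, then \<open>M\<close> determines \<tau>,
  and only then are the covers chosen.\<close>

lemma eventually_card_patterns_le:
  assumes temp: "tempered G F"
    and null: "hausdorff_measure (full_shift G A) d s X = 0" and s: "s \<ge> 0" and \<xi>: "\<xi> > 0"
  shows "eventually (\<lambda>n. real (card (patterns X (F n))) \<le> exp ((s + \<xi>) * cardF n)) sequentially"
proof (cases "X = {}")
  case True
  then show ?thesis by (simp add: patterns_def)
next
  case False
  define D where "D n = (\<Union>k<n. (set_inv (F k)) <#> F n)" for n
  obtain C where C: "C > 0" "\<And>n. real (card (D n)) \<le> C * cardF n"
    using temp by (auto simp: tempered_def D_def)
  have D: "finite (D n)" "D n \<subseteq> carrier G" for n
    using F unfolding D_def set_mult_def SET_INV_def by (auto simp: subset_iff)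
  obtain \<epsilon> where \<epsilon>: "0 < \<epsilon>" "\<epsilon> \<le> 1 / 2" "s / (1 - \<epsilon>) \<le> s + \<xi> / 3"
    using ex_inflation_factor[of s "\<xi> / 3"] s \<xi> by auto
  define la where "la = ln (real (card A))"
  have la: "la \<ge> 0" unfolding la_def by (cases "card A = 0") auto
  define \<eta> where "\<eta> = \<xi> / (3 * (la + 1))"
  have \<eta>: "\<eta> > 0" "\<eta> * la \<le> \<xi> / 3" using la \<xi> by (auto simp: \<eta>_def field_simps)
  obtain M where M: "(1 - 1 / (1 / \<epsilon> + C / (1 - \<epsilon>))) ^ M \<le> \<eta> / 2"
    using ex_layer_count[OF \<epsilon>(1,2) less_imp_le[OF C(1)] \<eta>(1)] by blast
  define \<tau> where "\<tau> = \<xi> / (3 * (real M + 1))"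
  have \<tau>: "\<tau> > 0" "real M * \<tau> \<le> \<xi> / 3" using \<xi> by (auto simp: \<tau>_def field_simps)
  define good :: "(nat \<times> ('a \<Rightarrow> 'b)) set \<Rightarrow> bool" where
    "good Q \<longleftrightarrow> finite Q \<and> (\<forall>x\<in>X. \<exists>r\<in>Q. \<forall>g\<in>F (fst r). x g = snd r g) \<and>
      (\<Sum>r\<in>Q. exp (- s * cardF (fst r))) \<le> \<tau>" for Q
  have ex: "\<exists>Q. good Q \<and> (\<forall>n\<in>fst ` Q. N \<le> n)" for N
  proof (rule finite_cylinder_cover[OF null s \<tau>(1), of N])
    fix Q :: "(nat \<times> ('a \<Rightarrow> 'b)) set"
    assume "finite Q" "\<And>r. r \<in> Q \<Longrightarrow> N \<le> fst r"
      "\<And>x. x \<in> X \<Longrightarrow> \<exists>r\<in>Q. \<forall>g\<in>F (fst r). x g = snd r g"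
      "(\<Sum>r\<in>Q. exp (- s * cardF (fst r))) \<le> \<tau>"
    then show ?thesis by (intro exI[of _ Q]) (auto simp: good_def)
  qed
  \<comment> \<open>If \<open>t \<otimes> g\<close> lies in \<open>F m\<close> for some
    \<open>t\<close> in \<open>F k\<close>, then \<open>g\<close> is \<open>inv t\<close> times that
    element. This is how the sets in the definition of temperedness enter.\<close>
  have TD: "g \<in> D m" if km: "k < m" "g \<in> carrier G" "(F k #> g) \<inter> F m \<noteq> {}" for k m g
  proof -
    obtain t where t: "t \<in> F k" "t \<otimes> g \<in> F m" using km(3) by (auto simp: r_coset_def)
    then have "t \<in> carrier G" using F(3) by blast
    then have "g = inv t \<otimes> (t \<otimes> g)" using km(2) by (simp add: m_assoc[symmetric])
    moreover have "inv t \<in> set_inv (F k)" using t by (auto simp: SET_INV_def)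
    ultimately have "g \<in> set_inv (F k) <#> F m" using t(2) unfolding set_mult_def by blast
    then show ?thesis using km(1) by (auto simp: D_def)
  qed
  obtain Q where Q: "\<And>j. good (Q j)" and
    tiling: "eventually (\<lambda>n. \<forall>\<nu>. (\<forall>j<M. \<forall>c\<in>F n. \<nu> j c \<in> fst ` Q j) \<longrightarrow>
      (\<exists>S. S \<subseteq> {..<M} \<times> F n \<and> (\<forall>p\<in>S. F (\<nu> (fst p) (snd p)) #> snd p \<subseteq> F n) \<and>
        (1 - \<epsilon>) * (\<Sum>p\<in>S. cardF (\<nu> (fst p) (snd p))) \<le> cardF n \<and>
        real (card (F n - (\<Union>p\<in>S. F (\<nu> (fst p) (snd p)) #> snd p))) \<le> \<eta> * cardF n)) sequentially"
  proof (rule folner_quasi_tiling[OF folner D C(2) less_imp_le[OF C(1)] \<epsilon>(1,2) \<eta>(1) M ex], goal_cases)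
    case (1 q) then show ?case by (simp add: good_def)
  next
    case (2 q k m g) then show ?case by (intro TD[of k m g])
  next
    case (3 Q) show ?case by (rule 3(1)[of Q, OF 3(2) 3(3)[OF folner]])
  qed
  from tiling show ?thesis
  proof (rule eventually_mono)
    fix n
    assume tile: "\<forall>\<nu>. (\<forall>j<M. \<forall>c\<in>F n. \<nu> j c \<in> fst ` Q j) \<longrightarrow>
      (\<exists>S. S \<subseteq> {..<M} \<times> F n \<and> (\<forall>p\<in>S. F (\<nu> (fst p) (snd p)) #> snd p \<subseteq> F n) \<and>
        (1 - \<epsilon>) * (\<Sum>p\<in>S. cardF (\<nu> (fst p) (snd p))) \<le> cardF n \<and>
        real (card (F n - (\<Union>p\<in>S. F (\<nu> (fst p) (snd p)) #> snd p))) \<le> \<eta> * cardF n)"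
    have "real (card (patterns X (F n))) \<le> exp (cardF n * (\<eta> * la + s / (1 - \<epsilon>) + real M * \<tau>))"
      unfolding la_def
    proof (rule card_patterns_le_weights[where F = F and Q = Q])
      show "\<epsilon> < 1" using \<epsilon> by simp
      fix \<nu> :: "nat \<Rightarrow> 'a \<Rightarrow> nat"
      assume "\<forall>j<M. \<forall>c\<in>F n. \<nu> j c \<in> fst ` Q j"
      then show "\<exists>S. S \<subseteq> {..<M} \<times> F n \<and> (\<forall>p\<in>S. F (\<nu> (fst p) (snd p)) #> snd p \<subseteq> F n) \<and>
        (1 - \<epsilon>) * (\<Sum>p\<in>S. cardF (\<nu> (fst p) (snd p))) \<le> cardF n \<and>
        real (card (F n - (\<Union>p\<in>S. F (\<nu> (fst p) (snd p)) #> snd p))) \<le> \<eta> * cardF n"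
        using tile by blast
    qed (use F Q s False in \<open>auto simp: good_def\<close>)
    also have "\<dots> \<le> exp ((s + \<xi>) * cardF n)"
    proof -
      have "\<eta> * la + s / (1 - \<epsilon>) + real M * \<tau> \<le> s + \<xi>" using \<eta>(2) \<epsilon>(3) \<tau>(2) by linarith
      then have "cardF n * (\<eta> * la + s / (1 - \<epsilon>) + real M * \<tau>) \<le> cardF n * (s + \<xi>)"
        by (intro mult_left_mono) auto
      then show ?thesis by (simp add: mult.commute)
    qed
    finally show "real (card (patterns X (F n))) \<le> exp ((s + \<xi>) * cardF n)" .
  qed
qed

text \<open>Cover numbers are bounded by pattern counts on \<open>K <#> F n\<close>, a set which
  exceeds \<open>F n\<close> only by boundary points. These at most \<open>\<xi> * cardF n\<close>
  places have at most \<open>card A\<close> symbols each, so the entropy is at most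
  \<open>s + \<xi> + \<xi> * la\<close> for every positive \<xi>.\<close>

lemma cover_entropy_le:
  assumes temp: "tempered G F"
    and null: "hausdorff_measure (full_shift G A) d s X = 0" and s: "s \<ge> 0"
    and \<U>: "\<U> \<in> finite_open_covers (full_shift G A) X"
  shows "cover_entropy G X \<U> \<le> s"
proof -
  interpret covered_subshift G A X \<U> by unfold_locales (rule \<U>)
  have am: "amenable G" using folner by (auto simp: amenable_def)
  obtain K0 where K0: "finite K0" "K0 \<subseteq> carrier G"
    "\<And>y. y \<in> X \<Longrightarrow> \<exists>U\<in>\<U>. \<forall>x\<in>X. (\<forall>g\<in>K0. x g = y g) \<longrightarrow> x \<in> U"
  proof (rule lebesgue_window)
    fix K
    assume "finite K" "K \<subseteq> carrier G"
      "\<And>y. y \<in> X \<Longrightarrow> \<exists>U\<in>\<U>. \<forall>x\<in>X. (\<forall>g\<in>K. x g = y g) \<longrightarrow> x \<in> U"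
    then show thesis by (rule that[of K])
  qed
  define K where "K = insert \<one> K0"
  have K: "finite K" "K \<subseteq> carrier G" using K0 by (auto simp: K_def)
  have Kw: "\<exists>U\<in>\<U>. \<forall>x\<in>X. (\<forall>g\<in>K. x g = y g) \<longrightarrow> x \<in> U" if "y \<in> X" for y
    using K0(3)[OF that] by (auto simp: K_def)
  \<comment> \<open>A point \<open>k \<otimes> f\<close> outside \<open>F n\<close> is brought back
    into \<open>F n\<close> by \<open>inv k\<close>, so the relevant boundary is the one for the
    inverses.\<close>
  define K' where "K' = (\<lambda>k. inv k) ` K"
  have K': "finite K'" "K' \<subseteq> carrier G" using K by (auto simp: K'_def)
  define la where "la = ln (real (card A))"
  have la: "la \<ge> 0" unfolding la_def by (cases "card A = 0") auto
  have main: "cover_entropy G X \<U> \<le> s + \<xi> + \<xi> * la" if \<xi>: "\<xi> > 0" for \<xi>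
  proof (rule tendsto_upperbound[OF cover_entropy_limit[OF am folner]])
    show "eventually (\<lambda>n. ln (real (N (F n))) / cardF n \<le> s + \<xi> + \<xi> * la) sequentially"
      using eventually_card_patterns_le[OF temp null s \<xi>] folner_bdry[OF folner K' \<xi>]
    proof eventually_elim
      case (elim n)
      define B where "B = (K <#> F n) - F n"
      have KF: "finite (K <#> F n)" "K <#> F n \<subseteq> carrier G"
        using K F by (auto simp: set_mult_def subset_iff)
      have ne: "cardF n > 0" using F by (simp add: card_gt_0_iff)
      have "F n \<subseteq> K <#> F n"
      proof
        fix f assume f: "f \<in> F n"
        then have "f \<in> carrier G" using F(3) by blast
        then have "f = \<one> \<otimes> f" by simp
        then show "f \<in> K <#> F n" using f unfolding K_def set_mult_def by blast
      qed
      then have eq: "K <#> F n = F n \<union> B" by (auto simp: B_def)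
      have "B \<subseteq> bdry G K' (F n)"
      proof
        fix c assume c: "c \<in> B"
        then obtain k f where kf: "k \<in> K" "f \<in> F n" "c = k \<otimes> f" "c \<notin> F n" by (auto simp: B_def set_mult_def)
        then have G: "k \<in> carrier G" "f \<in> carrier G" using K(2) F(3) by blast+
        then have "inv k \<otimes> c = f" using kf(3) by (simp add: m_assoc[symmetric])
        then show "c \<in> bdry G K' (F n)" using kf G by (auto simp: bdry_def K'_def intro!: bexI[of _ k])
      qed
      then have "card B \<le> card (bdry G K' (F n))" using finite_bdry[OF K'] F by (intro card_mono) auto
      then have cB: "real (card B) \<le> \<xi> * cardF n" using elim(2) by linarith
      have "N (F n) \<le> card (patterns X (K <#> F n))" using N_le_card_patterns[OF Kw K] F by blast
      also have "\<dots> \<le> card (patterns X (F n)) * card A ^ card B"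
        unfolding eq using F KF by (intro card_patterns_Un_le) (auto simp: B_def)
      finally have N: "N (F n) \<le> card (patterns X (F n)) * card A ^ card B" .
      show ?case
      proof (cases "N (F n) = 0")
        case True
        then show ?thesis using s \<xi> la by simp
      next
        case False
        then have "X \<noteq> {}" using N by (auto simp: patterns_def)
        then obtain x where "x \<in> X" by auto
        then have "x \<one> \<in> A" using X_apply by auto
        then have a: "card A > 0" using finite_A card_gt_0_iff by blast
        have P: "card (patterns X (F n)) > 0" using N False by (cases "card (patterns X (F n)) = 0") auto
        have "ln (real (N (F n))) \<le> ln (real (card (patterns X (F n)) * card A ^ card B))"
          using N False a P by (subst ln_le_cancel_iff) (auto simp del: of_nat_mult of_nat_power)
        also have "\<dots> = ln (real (card (patterns X (F n)))) + real (card B) * la"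
          using a P by (simp add: ln_mult ln_realpow la_def)
        also have "ln (real (card (patterns X (F n)))) \<le> ln (exp ((s + \<xi>) * cardF n))"
          using elim(1) P by (subst ln_le_cancel_iff) auto
        also have "real (card B) * la \<le> \<xi> * cardF n * la" using cB la by (intro mult_right_mono)
        finally have "ln (real (N (F n))) \<le> (s + \<xi> + \<xi> * la) * cardF n" by (simp add: algebra_simps)
        then show ?thesis using ne by (simp add: pos_divide_le_eq)
      qed
    qed
  qed simp
  show ?thesis
  proof (rule field_le_epsilon)
    fix e :: real assume e: "e > 0"
    \<comment> \<open>The excess is \<open>\<xi> * (1 + la)\<close>, which equals \<open>e\<close>
      for this choice of \<xi>.\<close>
    have "cover_entropy G X \<U> \<le> s + e / (1 + la) + e / (1 + la) * la"
      using e la by (intro main) auto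
    also have "\<dots> = s + (e / (1 + la)) * (1 + la)" by (simp only: distrib_left mult_1_right add.assoc)
    also have "\<dots> = s + e" using la by simp
    finally show "cover_entropy G X \<U> \<le> s + e" .
  qed
qed

lemma h_top_le_hausdorff_dim:
  assumes "tempered G F"
  shows "h_top G A X \<le> hausdorff_dim (full_shift G A) d X"
  unfolding h_top_def hausdorff_dim_def
proof (intro SUP_least Inf_greatest)
  fix \<U> z
  assume \<U>: "\<U> \<in> finite_open_covers (full_shift G A) X"
    and "z \<in> ereal ` {s. s \<ge> 0 \<and> hausdorff_measure (full_shift G A) d s X = 0}"
  then obtain s where "z = ereal s" "s \<ge> 0" "hausdorff_measure (full_shift G A) d s X = 0" by blast
  then show "ereal (cover_entropy G X \<U>) \<le> z" using cover_entropy_le[OF assms _ _ \<U>] by simp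
qed

text \<open>The generating cover alone suffices, since its cover numbers dominate the pattern
  counts. For \<open>s\<close> above its entropy, a rate strictly between the two bounds the pattern
  counts eventually, and the measure at \<open>s\<close> vanishes.\<close>

lemma hausdorff_dim_le_h_top: "hausdorff_dim (full_shift G A) d X \<le> h_top G A X"
proof -
  interpret covered_subshift G A X generator by unfold_locales (rule generator_cover)
  define h where "h = cover_entropy G X generator"
  have am: "amenable G" using folner by (auto simp: amenable_def)
  have lim: "(\<lambda>n. ln (real (N (F n))) / cardF n) \<longlonglongrightarrow> h"
    unfolding h_def by (rule cover_entropy_limit[OF am folner])
  have ln_nonneg: "0 \<le> ln (real (N (F n)))" for n by (cases "N (F n) = 0") auto
  have h0: "h \<ge> 0" by (rule LIMSEQ_le_const[OF lim]) (use ln_nonneg in auto)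
  have "hausdorff_dim (full_shift G A) d X \<le> ereal s" if s: "s > h" for s
  proof -
    define h' where "h' = (h + s) / 2"
    have h': "h < h'" "h' < s" using s by (auto simp: h'_def)
    have "eventually (\<lambda>n. ln (real (N (F n))) / cardF n < h') sequentially"
      using order_tendstoD(2)[OF lim h'(1)] .
    then have "eventually (\<lambda>n. real (card (patterns X (F n))) \<le> exp (h' * cardF n)) sequentially"
    proof eventually_elim
      case (elim n)
      have ne: "cardF n > 0" using F by (simp add: card_gt_0_iff)
      have le: "card (patterns X (F n)) \<le> N (F n)" by (rule card_patterns_le_generator[OF F(1,3)])
      show ?case
      proof (cases "N (F n) = 0")
        case False
        then have "real (N (F n)) = exp (ln (real (N (F n))))" by simp
        also have "\<dots> \<le> exp (h' * cardF n)" using elim ne by (simp add: pos_divide_less_eq)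
        finally show ?thesis using le by linarith
      qed (use le in auto)
    qed
    then have "hausdorff_measure (full_shift G A) d s X = 0"
      using h' h0 s by (intro hausdorff_measure_null[of s h']) auto
    then show ?thesis unfolding hausdorff_dim_def using h0 s by (intro Inf_lower) auto
  qed
  then have "hausdorff_dim (full_shift G A) d X \<le> ereal h + ereal e" if "e > 0" for e
    using that by simp
  then have "hausdorff_dim (full_shift G A) d X \<le> ereal h" by (rule ereal_le_epsilon2)
  also have "\<dots> \<le> h_top G A X"
    unfolding h_top_def h_def by (intro SUP_upper generator_cover)
  finally show ?thesis .
qed

end

theorem mainTheorem2:
  fixes G :: "('g, 'm) monoid_scheme"
    and A :: "'a set"
    and X :: "('g \<Rightarrow> 'a) set"
    and F :: "nat \<Rightarrow> 'g set"
  assumes "group G"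
    and "countable (carrier G)"
    and "infinite (carrier G)"
    and "amenable G"
    and "finite A"
    and "subshift G A X"
    and "folner_sequence G F"
    and "tempered G F"
    and "\<And>n. F n \<subseteq> F (Suc n)"
    and "(\<Union>n. F n) = carrier G"
  shows "hausdorff_dim (full_shift G A) (shift_dist F) X = h_top G A X"
proof -
  interpret group G by fact
  interpret folner_shift G A X F by unfold_locales fact+
  show ?thesis
    using hausdorff_dim_le_h_top h_top_le_hausdorff_dim[OF \<open>tempered G F\<close>] by (rule antisym)
qed

end
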